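(* Let $k$ and $m$ be fixed positive integers with $2\leq k\leq m$. Let $q$ be an odd prime power. Then as $q\to\infty$, the number of $k$-Diophantine $m$-tuples in $\mathbb{F}_q$ is $$\frac{q^m}{m!\cdot 2^{\binom{m}{k}}}+o(q^m).$$
   Context: $\mathbb{F}_q$ is the finite field with $q$ elements. A $k$-Diophantine $m$-tuple in $\mathbb{F}_q$ is a subset $A\subset\mathbb{F}_q$ with $|A|=m$ (an unordered set of $m$ distinct elements) such that $a_1a_2\cdots a_k+1$ is a square in $\mathbb{F}_q$ ($0$ counts as a square) whenever $a_1,a_2,\ldots,a_k$ are distinct elements of $A$. *)

theory Defs
  imports
    "HOL-Algebra.Algebra"
    "HOL-Number_Theory.Prime_Powers"
    "HOL-Library.Landau_Symbols"
begin

definition square_in :: "('a, 'b) ring_scheme \<Rightarrow> 'a \<Rightarrow> bool" where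
  "square_in R x \<longleftrightarrow> (\<exists>y\<in>carrier R. x = y [^]\<^bsub>R\<^esub> (2::nat))"

definition diophantine_tuple ::
  "nat \<Rightarrow> nat \<Rightarrow> ('a, 'b) ring_scheme \<Rightarrow> 'a set \<Rightarrow> bool" where
  "diophantine_tuple k m R A \<longleftrightarrow>
     A \<subseteq> carrier R \<and> finite A \<and> card A = m \<and>
     (\<forall>a. a \<in> {1..k} \<rightarrow> A \<and> inj_on a {1..k} \<longrightarrow>
        square_in R ((\<Otimes>\<^bsub>R\<^esub>i\<in>{1..k}. a i) \<oplus>\<^bsub>R\<^esub> \<one>\<^bsub>R\<^esub>))"

definition odd_prime_powers :: "nat set" where
  "odd_prime_powers = {q. odd q \<and> primepow q}"

end

theory Submission
  imports Defs "HOL-Decision_Procs.Algebra_Aux"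
begin

text \<open>Write $\chi$ for the quadratic character of $\mathbb{F}_q$ with $\chi(0) = 0$. For an ordered tuple
$(x_1, \ldots, x_m)$ of field elements and a $k$-subset $S$ of the index set put
$x_S = \prod_{i \in S} x_i$. Apart from the tuples with a repeated entry or with some $x_S = -1$,
which number $O(q^{m-1})$ because one coordinate is then determined by the others, the product
$\prod_S (1 + \chi(x_S + 1))$ equals $2^N$, with $N = \binom{m}{k}$, on the tuples that enumerate a
$k$-Diophantine set and vanishes on all others. Each set is enumerated by $m!$ tuples, so the claim is
that this product has sum $q^m + o(q^m)$ over all tuples.

Expanding the product, the empty family of subsets contributes $q^m$. A nonempty family
$\mathcal{F}$ contributes $\sum_x \prod_{S \in \mathcal{F}} \chi(x_S + 1)$. Fix an index $i$ that lies
in some member of $\mathcal{F}$ and sum over $t = x_i$ first. The factors that depend on $t$ are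
$\chi(c_S t + 1)$, where $c_S$ is the product of the entries of $S$ other than $x_i$. Outside a set of
$O(q^{m-2})$ choices of the other entries the $c_S$ are nonzero and pairwise distinct
(\<open>pattern_sum_bound\<close>), and then the inner sum is $o(q)$, uniformly in the $c_S$.

This last estimate is a weak form of Weil's bound for $\sum_t \chi(f(t))$ with
$f = \prod_S (c_S X + 1)$, and Stepanov's method gives it (\<open>stepanov_bound\<close>). Let
$g = f^{(q-1)/2}$, so that $g(t) = \pm 1$ tells whether $f(t)$ is a square. For a sign
$\epsilon$ one constructs a nonzero polynomial
$F = \sum_{i \le k} (a_i + g b_i) X^{qi}$ that vanishes to order $M = 2k + 1$ at every $t$ with
$g(t) = \epsilon$. In the local ring at $t$ both $X^q$ and $g$ are, to order $M$, explicit expressions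
in $t$ and $f(t)$, so vanishing is a linear condition on the $a_i$, $b_i$, and its Taylor coefficients
are polynomials whose degrees do not depend on $q$. There are $2k + 2$ unknown polynomials and $2k + 1$
equations over $\mathbb{F}_q[X]$, hence a nontrivial solution of bounded degree exists
(\<open>vanishing_combination\<close>). That $F$ itself is nonzero follows modulo $X^q$: a
relation $a + g b = 0$ would give $f a^2 = b^2$, which the simple roots of $f$ exclude
(\<open>auxiliary_polynomial_nonzero\<close>). Comparing the degree of $F$ with the number of its zeros
bounds the number of such $t$ by $\frac{q}{2} + O(\frac{q}{M}) + O_M(1)$, for either sign. So the two signs occur almost equally often, and $M$ may be taken as large as one wishes.\<close>

section \<open>Divisibility and truncated binomial expansions in commutative rings\<close>

context cring
begin

lemma divides_add:
  assumes "a divides b" "a divides c" "a \<in> carrier R"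
  shows "a divides (b \<oplus> c)"
proof -
  obtain s t where "s \<in> carrier R" "b = a \<otimes> s" "t \<in> carrier R" "c = a \<otimes> t"
    using assms by (auto simp: factor_def)
  then show ?thesis
    using assms(3) by (auto simp: factor_def r_distr intro!: bexI[of _ "s \<oplus> t"])
qed

lemma divides_mult_left:
  assumes "a divides b" "a \<in> carrier R" "c \<in> carrier R"
  shows "a divides (c \<otimes> b)"
proof -
  obtain s where "s \<in> carrier R" "b = a \<otimes> s"
    using assms by (auto simp: factor_def)
  then show ?thesis
    using assms(2,3) by (auto simp: factor_def m_lcomm intro!: bexI[of _ "c \<otimes> s"])
qed

lemma pow_divides_pow:
  assumes "a divides b" "a \<in> carrier R"
  shows "a [^] (n::nat) divides b [^] n"
proof -
  obtain s where "s \<in> carrier R" "b = a \<otimes> s"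
    using assms by (auto simp: factor_def)
  then show ?thesis
    using assms(2) by (auto simp: factor_def nat_pow_distrib intro!: bexI[of _ "s [^] n"])
qed

lemma divides_mult_diff:
  assumes "a divides (b \<ominus> b')" "a divides (c \<ominus> c')"
    and [simp]: "a \<in> carrier R" "b \<in> carrier R" "b' \<in> carrier R" "c \<in> carrier R" "c' \<in> carrier R"
  shows "a divides (b \<otimes> c \<ominus> b' \<otimes> c')"
proof -
  have "b \<otimes> c \<ominus> b' \<otimes> c' = c \<otimes> (b \<ominus> b') \<oplus> b' \<otimes> (c \<ominus> c')"
    using assms(3-7) by algebra
  then show ?thesis
    using assms by (simp add: divides_add divides_mult_left)
qed

lemma divides_zero: "a \<in> carrier R \<Longrightarrow> a divides \<zero>"
  by (auto simp: factor_def intro!: bexI[of _ "\<zero>"])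

lemma divides_pow_diff:
  assumes "a divides (b \<ominus> c)" and [simp]: "a \<in> carrier R" "b \<in> carrier R" "c \<in> carrier R"
  shows "a divides (b [^] (n::nat) \<ominus> c [^] n)"
proof (induction n)
  case 0
  then show ?case by (simp add: divides_zero a_minus_def r_neg)
next
  case (Suc n)
  then show ?case using assms by (simp add: divides_mult_diff)
qed

lemma divides_finsum:
  assumes "finite I" "\<And>i. i \<in> I \<Longrightarrow> a divides (u i)" "a \<in> carrier R" "u \<in> I \<rightarrow> carrier R"
  shows "a divides (\<Oplus>i\<in>I. u i)"
  using assms
proof (induction I)
  case empty
  then show ?case by (simp add: divides_zero)
next
  case (insert i I)
  then show ?case by (auto simp: Pi_def intro!: divides_add)
qed

lemma finsum_diff:
  assumes "finite I" "u \<in> I \<rightarrow> carrier R" "v \<in> I \<rightarrow> carrier R"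
  shows "(\<Oplus>i\<in>I. u i) \<ominus> (\<Oplus>i\<in>I. v i) = (\<Oplus>i\<in>I. u i \<ominus> v i)"
  using assms
proof (induction I)
  case empty
  then show ?case by simp
next
  case (insert i I)
  define U V where "U = (\<Oplus>i\<in>I. u i)" and "V = (\<Oplus>i\<in>I. v i)"
  have UV: "U \<in> carrier R" "V \<in> carrier R" "u i \<in> carrier R" "v i \<in> carrier R"
    using insert by (auto simp: U_def V_def intro!: finsum_closed)
  have "u i \<oplus> U \<ominus> (v i \<oplus> V) = u i \<ominus> v i \<oplus> (U \<ominus> V)"
    using UV by (simp add: a_minus_def a_ac minus_add)
  then show ?case
    using insert by (simp add: U_def V_def Pi_def)
qed

text \<open>The value is $\sum_{l < m} \binom{n}{l} e^{m-l} d^l$: the first $m$ terms of $(e + d)^n$, divided by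
$e^n$ and multiplied by $e^m$. This scaling leaves no negative powers of $e$, and the degree in $e$ and
$d$ is $m$, however large $n$ is.\<close>

primrec trunc_binomial :: "nat \<Rightarrow> 'a \<Rightarrow> 'a \<Rightarrow> nat \<Rightarrow> 'a" where
  "trunc_binomial n e d 0 = \<zero>"
| "trunc_binomial n e d (Suc m) =
     e \<otimes> trunc_binomial n e d m \<oplus> \<guillemotleft>n choose m\<guillemotright>\<^sub>\<nat> \<otimes> (e \<otimes> d [^] m)"

lemma trunc_binomial_closed [simp]:
  "e \<in> carrier R \<Longrightarrow> d \<in> carrier R \<Longrightarrow> trunc_binomial n e d m \<in> carrier R"
  by (induction m) auto

text \<open>By Pascal's rule multiplication by $e + d$ raises $n$ by one, up to the factor $e$ that comes from the
scaling. The only excess is the term that the truncation cuts off.\<close>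

lemma trunc_binomial_pascal:
  assumes [simp]: "e \<in> carrier R" "d \<in> carrier R"
  shows "(e \<oplus> d) \<otimes> trunc_binomial n e d (Suc m)
    = e \<otimes> trunc_binomial (Suc n) e d (Suc m) \<oplus> \<guillemotleft>n choose m\<guillemotright>\<^sub>\<nat> \<otimes> (e \<otimes> d [^] Suc m)"
proof (induction m)
  case 0
  show ?case using assms by (simp add: r_distr l_distr m_ac)
next
  case (Suc m)
  define W W' D c c' where "W = trunc_binomial n e d (Suc m)"
    and "W' = trunc_binomial (Suc n) e d (Suc m)"
    and "D = d [^] Suc m" and "c = \<guillemotleft>n choose m\<guillemotright>\<^sub>\<nat>" and "c' = \<guillemotleft>n choose Suc m\<guillemotright>\<^sub>\<nat>"
  have cl: "W \<in> carrier R" "W' \<in> carrier R" "D \<in> carrier R" "c \<in> carrier R" "c' \<in> carrier R"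
    using assms trunc_binomial_closed[OF assms] unfolding W_def W'_def D_def c_def c'_def
    by (auto simp del: trunc_binomial.simps)
  have IH: "(e \<oplus> d) \<otimes> W = e \<otimes> W' \<oplus> c \<otimes> (e \<otimes> D)"
    using Suc unfolding W_def W'_def D_def c_def .
  have "(e \<oplus> d) \<otimes> (e \<otimes> W \<oplus> c' \<otimes> (e \<otimes> D))
      = e \<otimes> ((e \<oplus> d) \<otimes> W) \<oplus> c' \<otimes> (e \<otimes> (e \<otimes> D)) \<oplus> c' \<otimes> (e \<otimes> (D \<otimes> d))"
    using cl assms by algebra
  also have "\<dots> = e \<otimes> (e \<otimes> W' \<oplus> (c \<oplus> c') \<otimes> (e \<otimes> D)) \<oplus> c' \<otimes> (e \<otimes> (D \<otimes> d))"
    unfolding IH using cl assms by algebra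
  finally show ?case
    by (simp only: W_def W'_def D_def c_def c'_def trunc_binomial.simps(2)[of n _ _ "Suc m"]
        trunc_binomial.simps(2)[of "Suc n" _ _ "Suc m"] binomial_Suc_Suc of_nat_add nat_pow_Suc)
qed

lemma trunc_binomial_0:
  assumes [simp]: "e \<in> carrier R" "d \<in> carrier R"
  shows "trunc_binomial 0 e d (Suc m) = e [^] Suc m"
proof (induction m)
  case (Suc m)
  then show ?case
    by (simp only: trunc_binomial.simps(2)[of 0 _ _ "Suc m"]) (simp add: m_comm)
qed simp

lemma trunc_binomial_cong:
  assumes e: "e \<in> carrier R" and d: "d \<in> carrier R"
  shows "\<exists>s\<in>carrier R. (e \<oplus> d) [^] n \<otimes> e [^] Suc m
    = e [^] n \<otimes> trunc_binomial n e d (Suc m) \<oplus> d [^] Suc m \<otimes> s"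
proof (induction n)
  case 0
  show ?case
    unfolding trunc_binomial_0[OF e d] using e d by (intro bexI[of _ "\<zero>"]) auto
next
  case (Suc n)
  define W W' D c where "W = trunc_binomial n e d (Suc m)"
    and "W' = trunc_binomial (Suc n) e d (Suc m)"
    and "D = d [^] Suc m" and "c = \<guillemotleft>n choose m\<guillemotright>\<^sub>\<nat>"
  define A B E where "A = (e \<oplus> d) [^] n" and "B = e [^] n" and "E = e [^] Suc m"
  have cl: "W \<in> carrier R" "W' \<in> carrier R" "D \<in> carrier R" "c \<in> carrier R"
      "A \<in> carrier R" "B \<in> carrier R" "E \<in> carrier R"
    using e d trunc_binomial_closed[OF e d] unfolding W_def W'_def D_def c_def A_def B_def E_def
    by (auto simp del: trunc_binomial.simps)
  obtain s where s: "s \<in> carrier R" and IH: "A \<otimes> E = B \<otimes> W \<oplus> D \<otimes> s"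
    using Suc unfolding W_def W'_def D_def c_def A_def B_def E_def by blast
  have pas: "(e \<oplus> d) \<otimes> W = e \<otimes> W' \<oplus> c \<otimes> (e \<otimes> D)"
    using trunc_binomial_pascal[OF e d] unfolding W_def W'_def D_def c_def .
  have "A \<otimes> (e \<oplus> d) \<otimes> E = (e \<oplus> d) \<otimes> (A \<otimes> E)"
    using cl e d by algebra
  also have "\<dots> = B \<otimes> ((e \<oplus> d) \<otimes> W) \<oplus> D \<otimes> ((e \<oplus> d) \<otimes> s)"
    unfolding IH using cl e d s by algebra
  also have "\<dots> = B \<otimes> e \<otimes> W' \<oplus> D \<otimes> (B \<otimes> c \<otimes> e \<oplus> (e \<oplus> d) \<otimes> s)"
    unfolding pas using cl e d s by algebra
  finally have "A \<otimes> (e \<oplus> d) \<otimes> E = B \<otimes> e \<otimes> W' \<oplus> D \<otimes> (B \<otimes> c \<otimes> e \<oplus> (e \<oplus> d) \<otimes> s)" .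
  moreover have "B \<otimes> c \<otimes> e \<oplus> (e \<oplus> d) \<otimes> s \<in> carrier R"
    using cl e d s by simp
  ultimately show ?case
    unfolding W'_def[symmetric] D_def[symmetric] E_def[symmetric] nat_pow_Suc[of _ n]
      A_def[symmetric] B_def[symmetric]
    by blast
qed

text \<open>From $l \binom{p^s}{l} = p^s \binom{p^s - 1}{l - 1}$: if $p$ did not divide the binomial coefficient,
then $p^s$ would divide $l$.\<close>

lemma of_nat_choose_eq_0:
  assumes "Factorial_Ring.prime p" "\<guillemotleft>p\<guillemotright>\<^sub>\<nat> = \<zero>" "0 < l" "l < p ^ s"
  shows "\<guillemotleft>p ^ s choose l\<guillemotright>\<^sub>\<nat> = \<zero>"
proof -
  have "p dvd (p ^ s choose l)"
  proof (rule ccontr)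
    assume "\<not> p dvd (p ^ s choose l)"
    then have cop: "coprime (p ^ s) (p ^ s choose l)"
      using assms(1) by (simp add: prime_imp_coprime)
    have "l * (p ^ s choose l) = p ^ s * (p ^ s - 1 choose (l - 1))"
      using assms(3) by (simp add: times_binomial_minus1_eq)
    then have "p ^ s dvd l"
      using cop by (metis coprime_dvd_mult_left_iff dvd_triv_left)
    then show False
      using assms(3,4) by (simp add: nat_dvd_not_less)
  qed
  then obtain j where "(p ^ s choose l) = p * j" ..
  then show ?thesis
    using assms(2) by simp
qed

lemma trunc_binomial_prime_power:
  assumes "Factorial_Ring.prime p" "\<guillemotleft>p\<guillemotright>\<^sub>\<nat> = \<zero>" "m < p ^ s"
    and [simp]: "e \<in> carrier R" "d \<in> carrier R"
  shows "trunc_binomial (p ^ s) e d (Suc m) = e [^] Suc m"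
  using assms(3)
proof (induction m)
  case (Suc m)
  then show ?case
    using of_nat_choose_eq_0[OF assms(1,2), of "Suc m" s]
    by (simp only: trunc_binomial.simps(2)[of _ _ _ "Suc m"]) (simp add: m_comm)
qed simp

text \<open>The congruence $(e + d)^{p^s} \equiv e^{p^s}$ modulo $d^m$, multiplied by $e^m$: of the truncated binomial
expansion only the first term remains in characteristic $p$.\<close>

lemma frobenius_mod_power:
  assumes "Factorial_Ring.prime p" "\<guillemotleft>p\<guillemotright>\<^sub>\<nat> = \<zero>" "0 < m" "m \<le> p ^ s"
    and e: "e \<in> carrier R" and d: "d \<in> carrier R"
  shows "\<exists>u\<in>carrier R. (e \<oplus> d) [^] (p ^ s) \<otimes> e [^] m = e [^] (p ^ s) \<otimes> e [^] m \<oplus> d [^] m \<otimes> u"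
proof -
  obtain m' where "m = Suc m'" using assms(3) by (cases m) auto
  then show ?thesis
    using trunc_binomial_cong[OF e d, of "p ^ s" m'] assms(4)
      trunc_binomial_prime_power[OF assms(1,2) _ e d, of m' s] by (auto simp: less_eq_Suc_le)
qed

lemma square_expansion:
  assumes "a \<in> carrier R" "y \<in> carrier R" "b \<in> carrier R"
  shows "(a \<oplus> y \<otimes> b) \<otimes> (a \<oplus> y \<otimes> b) = a \<otimes> a \<oplus> y \<otimes> (b \<otimes> (a \<oplus> y \<otimes> b) \<oplus> a \<otimes> b)"
  using assms by algebra

lemma diff_eq_multiple:
  assumes eq: "p \<oplus> y \<otimes> s = r \<oplus> y \<otimes> u"
    and cl: "p \<in> carrier R" "r \<in> carrier R" "y \<in> carrier R" "s \<in> carrier R" "u \<in> carrier R"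
  shows "p \<ominus> r = y \<otimes> (u \<ominus> s)"
proof -
  have "p \<ominus> r = (p \<oplus> y \<otimes> s) \<ominus> y \<otimes> s \<ominus> r" using cl by algebra
  also have "\<dots> = (r \<oplus> y \<otimes> u) \<ominus> y \<otimes> s \<ominus> r" unfolding eq ..
  also have "\<dots> = y \<otimes> (u \<ominus> s)" using cl by algebra
  finally show ?thesis .
qed

end

section \<open>Multiplicities of roots of univariate polynomials\<close>

context UP_domain
begin

definition polys :: "nat \<Rightarrow> (nat \<Rightarrow> 'a) set" where
  "polys d = {p \<in> carrier P. UnivPoly.deg R p \<le> d}"

abbreviation "const c \<equiv> up_ring.monom P c 0"
abbreviation "indet \<equiv> up_ring.monom P \<one> 1"
definition "lin t = indet \<ominus>\<^bsub>P\<^esub> const t"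
definition "ev t p = UnivPoly.eval R R id t p"

lemma ev_closed [simp]: "t \<in> carrier R \<Longrightarrow> p \<in> carrier P \<Longrightarrow> ev t p \<in> carrier R"
  by (simp add: ev_def carrier_evalRR)

lemma ev_simps:
  assumes "t \<in> carrier R"
  shows "p \<in> carrier P \<Longrightarrow> q \<in> carrier P \<Longrightarrow> ev t (p \<oplus>\<^bsub>P\<^esub> q) = ev t p \<oplus> ev t q"
    and "p \<in> carrier P \<Longrightarrow> q \<in> carrier P \<Longrightarrow> ev t (p \<ominus>\<^bsub>P\<^esub> q) = ev t p \<ominus> ev t q"
    and "p \<in> carrier P \<Longrightarrow> q \<in> carrier P \<Longrightarrow> ev t (p \<otimes>\<^bsub>P\<^esub> q) = ev t p \<otimes> ev t q"
    and "ev t \<one>\<^bsub>P\<^esub> = \<one>"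
    and "ev t \<zero>\<^bsub>P\<^esub> = \<zero>"
    and "c \<in> carrier R \<Longrightarrow> ev t (const c) = c"
    and "ev t indet = t"
  using assms evalRR_monom[of \<zero> t 0] unfolding ev_def by (simp_all add: evalRR_simps)

lemma carrier_nontrivial: "carrier R \<noteq> {\<zero>}"
  using R.one_closed R.one_not_zero by blast

lemma pow_nonzero:
  assumes "p \<in> carrier P" "p \<noteq> \<zero>\<^bsub>P\<^esub>"
  shows "p [^]\<^bsub>P\<^esub> (n::nat) \<noteq> \<zero>\<^bsub>P\<^esub>"
  using assms by (induction n) (auto simp: integral_iff)

lemma R_pow_nonzero: "a \<in> carrier R \<Longrightarrow> a \<noteq> \<zero> \<Longrightarrow> a [^] (n::nat) \<noteq> \<zero>"
  by (induction n) (auto simp: R.integral_iff)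

lemma polys_carrier: "p \<in> polys d \<Longrightarrow> p \<in> carrier P"
  by (simp add: polys_def)

lemma polys_mono: "p \<in> polys d \<Longrightarrow> d \<le> e \<Longrightarrow> p \<in> polys e"
  by (auto simp: polys_def)

lemma polys_add: "p \<in> polys d \<Longrightarrow> q \<in> polys d \<Longrightarrow> p \<oplus>\<^bsub>P\<^esub> q \<in> polys d"
  by (auto simp: polys_def intro: order_trans[OF deg_add])

lemma polys_uminus: "p \<in> polys d \<Longrightarrow> \<ominus>\<^bsub>P\<^esub> p \<in> polys d"
  by (auto simp: polys_def)

lemma polys_diff: "p \<in> polys d \<Longrightarrow> q \<in> polys d \<Longrightarrow> p \<ominus>\<^bsub>P\<^esub> q \<in> polys d"
  using polys_add polys_uminus by (simp add: a_minus_def)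

lemma polys_zero: "\<zero>\<^bsub>P\<^esub> \<in> polys d"
  by (auto simp: polys_def)

lemma polys_one: "\<one>\<^bsub>P\<^esub> \<in> polys d"
  by (auto simp: polys_def)

lemma polys_mult: "p \<in> polys d \<Longrightarrow> q \<in> polys e \<Longrightarrow> p \<otimes>\<^bsub>P\<^esub> q \<in> polys (d + e)"
  by (auto simp: polys_def intro: order_trans[OF deg_mult_ring])

lemma polys_pow: "p \<in> polys d \<Longrightarrow> p [^]\<^bsub>P\<^esub> (n::nat) \<in> polys (d * n)"
  using polys_mult by (induction n) (auto simp: polys_one add.commute[of d])

lemma polys_const: "c \<in> carrier R \<Longrightarrow> const c \<in> polys d"
  by (auto simp: polys_def)

lemma polys_X: "0 < d \<Longrightarrow> indet \<in> polys d"
  by (auto simp: polys_def)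

lemma polys_finsum:
  assumes "finite I" "\<And>i. i \<in> I \<Longrightarrow> u i \<in> polys d"
  shows "(\<Oplus>\<^bsub>P\<^esub>i\<in>I. u i) \<in> polys d"
  using assms
proof (induction I)
  case (insert i I)
  then have "u \<in> I \<rightarrow> carrier P" "u i \<in> carrier P" using polys_carrier by auto
  then show ?case using insert by (simp add: polys_add)
qed (simp add: polys_zero)

lemma const_mult: "a \<in> carrier R \<Longrightarrow> b \<in> carrier R \<Longrightarrow> const (a \<otimes> b) = const a \<otimes>\<^bsub>P\<^esub> const b"
  using monom_mult[of a b 0 0] by simp

lemma const_pow: "a \<in> carrier R \<Longrightarrow> const (a [^] (n::nat)) = const a [^]\<^bsub>P\<^esub> n"
  by (induction n) (auto simp: const_mult simp del: monom_mult)

lemma const_of_nat: "const \<guillemotleft>n\<guillemotright>\<^sub>\<nat> = \<guillemotleft>n\<guillemotright>\<^sub>\<nat>\<^bsub>P\<^esub>"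
  by (induction n) (auto simp: P.of_nat_Suc)

lemma lin_closed [simp]: "t \<in> carrier R \<Longrightarrow> lin t \<in> carrier P"
  by (simp add: lin_def)

lemma deg_lin: "t \<in> carrier R \<Longrightarrow> UnivPoly.deg R (lin t) = 1"
  unfolding lin_def using deg_minus_monom carrier_nontrivial by blast

lemma lin_nonzero: "t \<in> carrier R \<Longrightarrow> lin t \<noteq> \<zero>\<^bsub>P\<^esub>"
  using deg_lin[of t] deg_nzero_nzero[of "lin t"] by simp

lemma ev_lin: "t \<in> carrier R \<Longrightarrow> s \<in> carrier R \<Longrightarrow> ev s (lin t) = s \<ominus> t"
  unfolding lin_def by (subst ev_simps) (simp_all add: ev_simps del: One_nat_def)

lemma remainder_at:
  assumes p: "p \<in> carrier P" and t: "t \<in> carrier R"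
  obtains p' where "p' \<in> carrier P" "p = lin t \<otimes>\<^bsub>P\<^esub> p' \<oplus>\<^bsub>P\<^esub> const (ev t p)"
    "p \<ominus>\<^bsub>P\<^esub> const (ev t p) = lin t \<otimes>\<^bsub>P\<^esub> p'"
proof -
  obtain p' where p': "p' \<in> carrier P" and eq: "p = lin t \<otimes>\<^bsub>P\<^esub> p' \<oplus>\<^bsub>P\<^esub> const (ev t p)"
    using remainder_theorem[OF p t carrier_nontrivial] unfolding lin_def ev_def by blast
  have c: "const (ev t p) \<in> carrier P"
    using p t by simp
  have "p \<ominus>\<^bsub>P\<^esub> const (ev t p) = (lin t \<otimes>\<^bsub>P\<^esub> p' \<oplus>\<^bsub>P\<^esub> const (ev t p)) \<ominus>\<^bsub>P\<^esub> const (ev t p)"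
    using eq by (rule arg_cong)
  also have "\<dots> = lin t \<otimes>\<^bsub>P\<^esub> p'"
    using c p' t by (simp add: a_minus_def P.a_assoc P.r_neg)
  finally show ?thesis using that[OF p' eq] by blast
qed

lemma polys_split_at:
  assumes "p \<in> polys (Suc d)" and t: "t \<in> carrier R"
  obtains p' where "p' \<in> polys d" "p = lin t \<otimes>\<^bsub>P\<^esub> p' \<oplus>\<^bsub>P\<^esub> const (ev t p)"
proof -
  have p: "p \<in> carrier P" using assms by (auto simp: polys_def)
  obtain p' where p': "p' \<in> carrier P" and eq: "p = lin t \<otimes>\<^bsub>P\<^esub> p' \<oplus>\<^bsub>P\<^esub> const (ev t p)"
    and diff: "p \<ominus>\<^bsub>P\<^esub> const (ev t p) = lin t \<otimes>\<^bsub>P\<^esub> p'"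
    using remainder_at[OF p t] by blast
  have "const (ev t p) \<in> polys (Suc d)"
    using p t by (intro polys_const ev_closed)
  then have "lin t \<otimes>\<^bsub>P\<^esub> p' \<in> polys (Suc d)"
    unfolding diff[symmetric] using assms(1) by (intro polys_diff)
  then have *: "UnivPoly.deg R (lin t \<otimes>\<^bsub>P\<^esub> p') \<le> Suc d" by (simp add: polys_def)
  have "UnivPoly.deg R p' \<le> d"
  proof (cases "p' = \<zero>\<^bsub>P\<^esub>")
    case False
    then have "UnivPoly.deg R (lin t \<otimes>\<^bsub>P\<^esub> p') = 1 + UnivPoly.deg R p'"
      using deg_mult[OF lin_nonzero _ lin_closed] deg_lin p' assms(2) by simp
    then show ?thesis using * by simp
  qed simp
  then show ?thesis using p' eq that[of p'] by (simp add: polys_def)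
qed

lemma root_factor:
  assumes p: "p \<in> carrier P" and t: "t \<in> carrier R" and root: "ev t p = \<zero>"
  obtains p' where "p' \<in> carrier P" "p = lin t \<otimes>\<^bsub>P\<^esub> p'"
    "p' = \<zero>\<^bsub>P\<^esub> \<or> UnivPoly.deg R p = Suc (UnivPoly.deg R p')"
proof -
  obtain p' where p': "p' \<in> carrier P" and diff: "p \<ominus>\<^bsub>P\<^esub> const (ev t p) = lin t \<otimes>\<^bsub>P\<^esub> p'"
    using remainder_at[OF p t] by blast
  have eq: "p = lin t \<otimes>\<^bsub>P\<^esub> p'"
    using diff p unfolding root by (simp add: a_minus_def)
  have "UnivPoly.deg R (lin t \<otimes>\<^bsub>P\<^esub> p') = Suc (UnivPoly.deg R p')" if "p' \<noteq> \<zero>\<^bsub>P\<^esub>"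
      using deg_mult[OF lin_nonzero that lin_closed] deg_lin p' t by simp
  then show ?thesis using p' eq that[of p'] by metis
qed

lemma ev_pow: "p \<in> carrier P \<Longrightarrow> t \<in> carrier R \<Longrightarrow> ev t (p [^]\<^bsub>P\<^esub> (n::nat)) = ev t p [^] n"
  by (induction n) (auto simp: ev_simps)

lemma lin_divides_diff_ev:
  assumes "p \<in> carrier P" "t \<in> carrier R"
  shows "lin t divides\<^bsub>P\<^esub> (p \<ominus>\<^bsub>P\<^esub> const (ev t p))"
  using remainder_at[OF assms] by (metis dividesI)

text \<open>A polynomial that does not vanish at $t$ is a unit in the local ring at $t$, so it may be cancelled from
a divisibility by a power of $X - t$.\<close>

lemma lin_power_cancel:
  assumes "lin t [^]\<^bsub>P\<^esub> (n::nat) divides\<^bsub>P\<^esub> (h \<otimes>\<^bsub>P\<^esub> p)" "ev t h \<noteq> \<zero>"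
    and [simp]: "h \<in> carrier P" "p \<in> carrier P" "t \<in> carrier R"
  shows "lin t [^]\<^bsub>P\<^esub> n divides\<^bsub>P\<^esub> p"
  using assms(1,4)
proof (induction n arbitrary: p)
  case 0
  then show ?case by (auto simp: factor_def intro!: bexI[of _ p])
next
  case (Suc n)
  define l L where "l = lin t" and "L = lin t [^]\<^bsub>P\<^esub> n"
  have l: "l \<in> carrier P" "L \<in> carrier P" "l \<noteq> \<zero>\<^bsub>P\<^esub>" "h \<in> carrier P"
    using lin_nonzero unfolding l_def L_def by (auto intro!: P.nat_pow_closed)
  obtain s where s: "s \<in> carrier P" "h \<otimes>\<^bsub>P\<^esub> p = L \<otimes>\<^bsub>P\<^esub> l \<otimes>\<^bsub>P\<^esub> s"
    using Suc.prems by (auto simp: factor_def l_def L_def)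
  have "ev t h \<otimes> ev t p = ev t (h \<otimes>\<^bsub>P\<^esub> p)" using Suc.prems by (simp add: ev_simps)
  also have "\<dots> = ev t L \<otimes> ev t l \<otimes> ev t s" using l s by (simp add: ev_simps)
  also have "ev t l = \<zero>" unfolding l_def ev_lin[OF assms(5,5)] by (simp add: a_minus_def R.r_neg)
  also have "ev t L \<otimes> \<zero> \<otimes> ev t s = \<zero>" using l s by (simp add: ev_simps)
  finally have "ev t p = \<zero>" using assms(2) Suc.prems
    by (metis R.integral ev_closed assms(3,5))
  then obtain p' where p': "p' \<in> carrier P" "p = l \<otimes>\<^bsub>P\<^esub> p'"
    using root_factor Suc.prems unfolding l_def by (metis assms(5))
  have "l \<otimes>\<^bsub>P\<^esub> (h \<otimes>\<^bsub>P\<^esub> p') = h \<otimes>\<^bsub>P\<^esub> p" using p' l by (simp add: P.m_lcomm)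
  also have "\<dots> = l \<otimes>\<^bsub>P\<^esub> (L \<otimes>\<^bsub>P\<^esub> s)" using s l by (simp add: P.m_ac)
  finally have "h \<otimes>\<^bsub>P\<^esub> p' = L \<otimes>\<^bsub>P\<^esub> s" using l p' s by (simp add: m_lcancel)
  then have "L divides\<^bsub>P\<^esub> (h \<otimes>\<^bsub>P\<^esub> p')" using s by (auto simp: factor_def)
  then have "L divides\<^bsub>P\<^esub> p'" using Suc.IH p' unfolding L_def by blast
  then obtain r where "r \<in> carrier P" "p' = L \<otimes>\<^bsub>P\<^esub> r" by (auto simp: factor_def)
  then have "p = L \<otimes>\<^bsub>P\<^esub> l \<otimes>\<^bsub>P\<^esub> r" "r \<in> carrier P" using p' l by (auto simp: P.m_ac)
  then show ?case unfolding l_def L_def by (auto simp: factor_def)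
qed

text \<open>Each zero of order $n$ is split off in turn. The remaining zeros keep their order since the split-off
power does not vanish there.\<close>

lemma card_multiple_roots_le_deg:
  assumes "finite S" "S \<subseteq> carrier R" "p \<in> carrier P" "p \<noteq> \<zero>\<^bsub>P\<^esub>"
    and "\<And>t. t \<in> S \<Longrightarrow> lin t [^]\<^bsub>P\<^esub> (n::nat) divides\<^bsub>P\<^esub> p"
  shows "n * card S \<le> UnivPoly.deg R p"
  using assms
proof (induction S arbitrary: p)
  case (insert t S)
  define L where "L = lin t [^]\<^bsub>P\<^esub> n"
  have t: "t \<in> carrier R" and L: "L \<in> carrier P"
    using insert.prems unfolding L_def by (auto intro!: P.nat_pow_closed)
  obtain p' where p': "p' \<in> carrier P" "p = L \<otimes>\<^bsub>P\<^esub> p'"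
    using insert.prems(4)[of t] unfolding L_def by (auto simp: factor_def)
  have nz: "p' \<noteq> \<zero>\<^bsub>P\<^esub>" "L \<noteq> \<zero>\<^bsub>P\<^esub>" using p' insert.prems L by auto
  have degL: "UnivPoly.deg R L = n" if "L = lin t [^]\<^bsub>P\<^esub> n" for L n using that
  proof (induction n arbitrary: L)
    case (Suc n)
    have "lin t [^]\<^bsub>P\<^esub> n \<noteq> \<zero>\<^bsub>P\<^esub>" using lin_nonzero[OF t] t by (intro pow_nonzero) auto
    then show ?case using Suc lin_nonzero[OF t] t deg_lin[OF t] by simp
  qed simp
  have "n * card S \<le> UnivPoly.deg R p'"
  proof (rule insert.IH)
    fix s assume s: "s \<in> S"
    then have sc: "s \<in> carrier R" "s \<noteq> t" using insert by auto
    have "ev s L = (s \<ominus> t) [^] n" unfolding L_def using sc t by (simp add: ev_pow ev_lin)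
    moreover have "s \<ominus> t \<noteq> \<zero>" using sc t by simp
    ultimately have "ev s L \<noteq> \<zero>" using sc t by (simp add: R_pow_nonzero)
    then show "lin s [^]\<^bsub>P\<^esub> n divides\<^bsub>P\<^esub> p'"
      using lin_power_cancel[of s n L p'] insert.prems(4)[of s] s p' L sc by simp
  qed (use insert.prems p' nz in auto)
  then show ?case using insert.hyps p' nz L degL[OF L_def] by (simp add: deg_mult)
qed simp

section \<open>Taylor expansions with uniform coefficients\<close>

text \<open>A family $G_t$ of polynomials, indexed by the points $t$, whose expansion
$G_t = \sum_{l < M} u_l (X - t)^l + (X - t)^M H_t$ has coefficients $u_l$ of degree at most $C$ that do
not depend on $t$. The $u_l$ are polynomials in $X$ and not in $t$; this is what makes the vanishing
conditions at all points $t$ a single system of $M$ equations over the polynomial ring. The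
recursion is Horner's scheme.\<close>

primrec taylor :: "nat \<Rightarrow> nat \<Rightarrow> ('a \<Rightarrow> (nat \<Rightarrow> 'a)) \<Rightarrow> bool" where
  "taylor 0 C G \<longleftrightarrow> (\<forall>t\<in>carrier R. G t \<in> carrier P)"
| "taylor (Suc M) C G \<longleftrightarrow> (\<exists>h\<in>polys C. \<exists>H. taylor M C H \<and>
      (\<forall>t\<in>carrier R. G t = h \<oplus>\<^bsub>P\<^esub> lin t \<otimes>\<^bsub>P\<^esub> H t))"

lemma taylor_closed: "taylor M C G \<Longrightarrow> t \<in> carrier R \<Longrightarrow> G t \<in> carrier P"
  by (induction M arbitrary: G) (auto intro!: P.a_closed P.m_closed dest: polys_carrier)

lemma taylor_cong:
  assumes "taylor M C G" "\<And>t. t \<in> carrier R \<Longrightarrow> G' t = G t"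
  shows "taylor M C G'"
  using assms by (cases M) auto

lemma taylor_Suc_imp: "taylor (Suc M) C G \<Longrightarrow> taylor M C G"
proof (induction M arbitrary: G)
  case 0
  then show ?case using taylor_closed by (metis taylor.simps(1))
next
  case (Suc M)
  then show ?case using taylor.simps(2)[of M C G] taylor.simps(2)[of "Suc M" C G] by blast
qed

lemma taylor_mono: "taylor M C G \<Longrightarrow> C \<le> D \<Longrightarrow> taylor M D G"
proof (induction M arbitrary: G)
  case (Suc M)
  then obtain h H where "h \<in> polys C" "taylor M C H"
    "\<forall>t\<in>carrier R. G t = h \<oplus>\<^bsub>P\<^esub> lin t \<otimes>\<^bsub>P\<^esub> H t" by auto
  then show ?case using Suc polys_mono by (auto intro!: bexI[of _ h] exI[of _ H])
qed simp

lemma taylor_poly: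
  assumes "h \<in> polys C"
  shows "taylor M C (\<lambda>_. h)"
  using assms
proof (induction M arbitrary: h)
  case (Suc M)
  then show ?case using polys_zero polys_carrier
    by (auto intro!: bexI[of _ h] exI[of _ "\<lambda>_. \<zero>\<^bsub>P\<^esub>"])
qed (simp add: polys_carrier)

lemma taylor_add:
  "taylor M C G \<Longrightarrow> taylor M C G' \<Longrightarrow> taylor M C (\<lambda>t. G t \<oplus>\<^bsub>P\<^esub> G' t)"
proof (induction M arbitrary: G G')
  case (Suc M)
  obtain h H where h: "h \<in> polys C" "taylor M C H"
    "\<forall>t\<in>carrier R. G t = h \<oplus>\<^bsub>P\<^esub> lin t \<otimes>\<^bsub>P\<^esub> H t" using Suc by auto
  obtain k K where k: "k \<in> polys C" "taylor M C K"
    "\<forall>t\<in>carrier R. G' t = k \<oplus>\<^bsub>P\<^esub> lin t \<otimes>\<^bsub>P\<^esub> K t" using Suc by auto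
  have "G t \<oplus>\<^bsub>P\<^esub> G' t = (h \<oplus>\<^bsub>P\<^esub> k) \<oplus>\<^bsub>P\<^esub> lin t \<otimes>\<^bsub>P\<^esub> (H t \<oplus>\<^bsub>P\<^esub> K t)" if "t \<in> carrier R" for t
    using h k that taylor_closed polys_carrier by (simp add: P.r_distr P.a_ac)
  then show ?case using h k Suc.IH[of H K] polys_add[of h C k] by auto
qed simp

lemma taylor_mult_poly:
  "h \<in> polys B \<Longrightarrow> taylor M C G \<Longrightarrow> taylor M (B + C) (\<lambda>t. h \<otimes>\<^bsub>P\<^esub> G t)"
proof (induction M arbitrary: G)
  case (Suc M)
  obtain k K where k: "k \<in> polys C" "taylor M C K"
    "\<forall>t\<in>carrier R. G t = k \<oplus>\<^bsub>P\<^esub> lin t \<otimes>\<^bsub>P\<^esub> K t" using Suc by auto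
  have "h \<otimes>\<^bsub>P\<^esub> G t = h \<otimes>\<^bsub>P\<^esub> k \<oplus>\<^bsub>P\<^esub> lin t \<otimes>\<^bsub>P\<^esub> (h \<otimes>\<^bsub>P\<^esub> K t)" if "t \<in> carrier R" for t
    using Suc.prems(1) k that taylor_closed polys_carrier by (simp add: P.r_distr P.m_lcomm)
  then show ?case using Suc k polys_mult[of h B k C] by auto
qed (simp add: polys_carrier)

lemma taylor_mult:
  "taylor M B G \<Longrightarrow> taylor M C G' \<Longrightarrow> taylor M (B + C) (\<lambda>t. G t \<otimes>\<^bsub>P\<^esub> G' t)"
proof (induction M arbitrary: G G')
  case (Suc M)
  obtain h H where h: "h \<in> polys B" "taylor M B H"
    "\<forall>t\<in>carrier R. G t = h \<oplus>\<^bsub>P\<^esub> lin t \<otimes>\<^bsub>P\<^esub> H t" using Suc by auto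
  obtain k K where k: "k \<in> polys C" "taylor M C K"
    "\<forall>t\<in>carrier R. G' t = k \<oplus>\<^bsub>P\<^esub> lin t \<otimes>\<^bsub>P\<^esub> K t" using Suc by auto
  have "G t \<otimes>\<^bsub>P\<^esub> G' t = h \<otimes>\<^bsub>P\<^esub> k \<oplus>\<^bsub>P\<^esub> lin t \<otimes>\<^bsub>P\<^esub> (h \<otimes>\<^bsub>P\<^esub> K t \<oplus>\<^bsub>P\<^esub> H t \<otimes>\<^bsub>P\<^esub> G' t)"
    if t: "t \<in> carrier R" for t
  proof -
    have cl: "h \<in> carrier P" "k \<in> carrier P" "H t \<in> carrier P" "K t \<in> carrier P"
        "lin t \<in> carrier P" "G' t \<in> carrier P"
      using h k t taylor_closed polys_carrier Suc.prems by auto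
    have "G t \<otimes>\<^bsub>P\<^esub> G' t = h \<otimes>\<^bsub>P\<^esub> G' t \<oplus>\<^bsub>P\<^esub> lin t \<otimes>\<^bsub>P\<^esub> (H t \<otimes>\<^bsub>P\<^esub> G' t)"
      using cl h(3) t by (simp add: P.l_distr P.m_assoc)
    also have "h \<otimes>\<^bsub>P\<^esub> G' t = h \<otimes>\<^bsub>P\<^esub> k \<oplus>\<^bsub>P\<^esub> lin t \<otimes>\<^bsub>P\<^esub> (h \<otimes>\<^bsub>P\<^esub> K t)"
      using cl k(3) t by (simp add: P.r_distr P.m_lcomm)
    finally show ?thesis using cl by (simp add: P.r_distr P.a_assoc)
  qed
  moreover have "taylor M (B + C) (\<lambda>t. h \<otimes>\<^bsub>P\<^esub> K t \<oplus>\<^bsub>P\<^esub> H t \<otimes>\<^bsub>P\<^esub> G' t)"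
    using h k Suc.prems Suc.IH[OF h(2) taylor_Suc_imp[OF Suc.prems(2)]]
    by (intro taylor_add taylor_mult_poly)
  ultimately show ?case using polys_mult[OF h(1) k(1)] by auto
qed simp

lemma taylor_pow:
  "taylor M C G \<Longrightarrow> taylor M (C * n) (\<lambda>t. G t [^]\<^bsub>P\<^esub> (n::nat))"
proof (induction n)
  case 0
  then show ?case by (simp add: taylor_poly polys_one)
next
  case (Suc n)
  then show ?case using taylor_mult[of M "C * n" "\<lambda>t. G t [^]\<^bsub>P\<^esub> n" C G] by (simp add: add.commute)
qed

lemma taylor_uminus:
  assumes "taylor M C G"
  shows "taylor M C (\<lambda>t. \<ominus>\<^bsub>P\<^esub> G t)"
proof (rule taylor_cong)
  show "taylor M C (\<lambda>t. (\<ominus>\<^bsub>P\<^esub> \<one>\<^bsub>P\<^esub>) \<otimes>\<^bsub>P\<^esub> G t)"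
    using taylor_mult_poly[OF polys_uminus[OF polys_one] assms, of 0] by simp
qed (simp add: P.l_minus taylor_closed[OF assms])

lemma taylor_var: "taylor M 1 (\<lambda>t. const t)"
proof (cases M)
  case (Suc M')
  have "const t = indet \<oplus>\<^bsub>P\<^esub> lin t \<otimes>\<^bsub>P\<^esub> (\<ominus>\<^bsub>P\<^esub> \<one>\<^bsub>P\<^esub>)" if "t \<in> carrier R" for t
    using that by (simp add: lin_def P.r_minus a_minus_def P.minus_add P.r_neg1 P.r_neg2)
  then show ?thesis unfolding Suc taylor.simps
    using taylor_poly[OF polys_uminus[OF polys_one]] polys_X[of 1] by (metis zero_less_one)
qed simp

lemma polys_0_const:
  assumes "p \<in> polys 0"
  obtains c where "c \<in> carrier R" "p = const c"
  using assms deg_zero_impl_monom[of p] that[of "up_ring.coeff P p 0"] by (auto simp: polys_def)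

text \<open>Values of a polynomial form such a family because $t = X - (X - t)$ does. Iterating
$f = X f' + f(0)$ reduces the general case to this one.\<close>

lemma taylor_ev:
  "f \<in> polys r \<Longrightarrow> taylor M r (\<lambda>t. const (ev t f))"
proof (induction r arbitrary: f)
  case 0
  then obtain c where c: "c \<in> carrier R" "f = const c" by (elim polys_0_const)
  show ?case
    by (rule taylor_cong[OF taylor_poly[OF polys_const[OF c(1)]]]) (simp add: c ev_simps)
next
  case (Suc r)
  obtain f' where f': "f' \<in> polys r" and eq: "f = lin \<zero> \<otimes>\<^bsub>P\<^esub> f' \<oplus>\<^bsub>P\<^esub> const (ev \<zero> f)"
    using polys_split_at[OF Suc.prems R.zero_closed] by blast
  define c where "c = ev \<zero> f"
  have c: "c \<in> carrier R" unfolding c_def using Suc.prems polys_carrier by (intro ev_closed) auto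
  have f'c: "f' \<in> carrier P" using f' polys_carrier by blast
  have "taylor M (1 + r) (\<lambda>t. const t \<otimes>\<^bsub>P\<^esub> const (ev t f') \<oplus>\<^bsub>P\<^esub> const c)"
    by (intro taylor_add taylor_mult taylor_var Suc.IH f' taylor_poly polys_const c)
  then show ?case
  proof (simp only: plus_1_eq_Suc, elim taylor_cong)
    fix t assume t: "t \<in> carrier R"
    have "ev t f = t \<otimes> ev t f' \<oplus> c"
      using t f'c c by (subst eq[folded c_def]) (simp add: ev_simps ev_lin a_minus_def)
    then show "const (ev t f) = const t \<otimes>\<^bsub>P\<^esub> const (ev t f') \<oplus>\<^bsub>P\<^esub> const c"
      using t c f'c ev_closed const_mult by simp
  qed
qed

text \<open>The remainders $H_l$ are kept along with the coefficients, so that a linear combination of several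
families can be expanded one order at a time.\<close>

lemma taylor_coefficients:
  "taylor M C G \<Longrightarrow> \<exists>u H. H 0 = G \<and> (\<forall>l<M. u l \<in> polys C) \<and>
     (\<forall>l\<le>M. \<forall>t\<in>carrier R. H l t \<in> carrier P) \<and>
     (\<forall>l<M. \<forall>t\<in>carrier R. H l t = u l \<oplus>\<^bsub>P\<^esub> lin t \<otimes>\<^bsub>P\<^esub> H (Suc l) t)"
proof (induction M arbitrary: G)
  case 0
  then show ?case by (auto intro!: exI[of _ "\<lambda>_. G"])
next
  case (Suc M)
  obtain h G' where h: "h \<in> polys C" "taylor M C G'"
    "\<forall>t\<in>carrier R. G t = h \<oplus>\<^bsub>P\<^esub> lin t \<otimes>\<^bsub>P\<^esub> G' t" using Suc by auto
  obtain u H where uH: "H 0 = G'" "\<forall>l<M. u l \<in> polys C"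
    "\<forall>l\<le>M. \<forall>t\<in>carrier R. H l t \<in> carrier P"
    "\<forall>l<M. \<forall>t\<in>carrier R. H l t = u l \<oplus>\<^bsub>P\<^esub> lin t \<otimes>\<^bsub>P\<^esub> H (Suc l) t"
    using Suc.IH[OF h(2)] by blast
  show ?case
  proof (intro exI[of _ "case_nat h u"] exI[of _ "case_nat G H"] conjI allI impI ballI)
    fix l t assume "l \<le> Suc M" "t \<in> carrier R"
    then show "(case l of 0 \<Rightarrow> G | Suc x \<Rightarrow> H x) t \<in> carrier P"
      using uH taylor_closed[OF Suc.prems] by (cases l) auto
  next
    fix l t assume "l < Suc M" "t \<in> carrier R"
    then show "(case l of 0 \<Rightarrow> G | Suc x \<Rightarrow> H x) t = (case l of 0 \<Rightarrow> h | Suc x \<Rightarrow> u x) \<oplus>\<^bsub>P\<^esub>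
        lin t \<otimes>\<^bsub>P\<^esub> (case Suc l of 0 \<Rightarrow> G | Suc x \<Rightarrow> H x) t"
      using uH h by (cases l) auto
  next
    fix l assume "l < Suc M"
    then show "(case l of 0 \<Rightarrow> h | Suc x \<Rightarrow> u x) \<in> polys C" using uH h by (cases l) auto
  qed simp
qed

section \<open>Siegel's lemma for polynomials\<close>

lemma card_polys:
  assumes "finite (carrier R)"
  shows "finite (polys d)" "card (polys d) = card (carrier R) ^ Suc d"
proof -
  have "bij_betw (\<lambda>p. restrict (up_ring.coeff P p) {..d}) (polys d) ({..d} \<rightarrow>\<^sub>E carrier R)"
    unfolding bij_betw_def
  proof (intro conjI inj_onI equalityI subsetI)
    fix p q assume pq: "p \<in> polys d" "q \<in> polys d"
      and eq: "restrict (up_ring.coeff P p) {..d} = restrict (up_ring.coeff P q) {..d}"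
    show "p = q"
    proof (rule up_eqI)
      fix n
      show "up_ring.coeff P p n = up_ring.coeff P q n"
      proof (cases "n \<le> d")
        case True
        then show ?thesis using fun_cong[OF eq, of n] by simp
      next
        case False
        then show ?thesis using pq by (auto simp: polys_def deg_aboveD)
      qed
    qed (use pq polys_carrier in auto)
  next
    fix c assume "c \<in> (\<lambda>p. restrict (up_ring.coeff P p) {..d}) ` polys d"
    then show "c \<in> {..d} \<rightarrow>\<^sub>E carrier R" using polys_carrier by (auto simp: PiE_def)
  next
    fix c assume c: "c \<in> {..d} \<rightarrow>\<^sub>E carrier R"
    define p where "p = (\<lambda>i. if i \<le> d then c i else \<zero>)"
    have pc: "p \<in> carrier P"
      using c unfolding p_def P_def UP_def up_def by (auto intro!: exI[of _ d])
    have co: "up_ring.coeff P p i = p i" for i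
      using pc unfolding P_def UP_def by simp
    have pm: "p i = \<zero>" if "d < i" for i using that by (simp add: p_def)
    have pn: "p i = c i" if "i \<le> d" for i using that by (simp add: p_def)
    have "p \<in> polys d"
      using pc pm by (auto simp: polys_def co intro!: deg_aboveI)
    moreover have "restrict (up_ring.coeff P p) {..d} = c"
      using c pn by (auto simp: co fun_eq_iff PiE_def extensional_def)
    ultimately show "c \<in> (\<lambda>p. restrict (up_ring.coeff P p) {..d}) ` polys d" by force
  qed
  from bij_betw_finite[OF this] bij_betw_same_card[OF this]
  show "finite (polys d)" "card (polys d) = card (carrier R) ^ Suc d"
    using assms by (auto simp: card_PiE finite_PiE)
qed

text \<open>The pigeonhole principle in the style of Siegel's lemma. There are $q^{(MC + 1)(M + 1)}$ vectors of
$M + 1$ polynomials of degree at most $MC$. Their images are vectors of $M$ polynomials of degree at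
most $MC + C$, of which there are only $q^{(MC + C + 1) M}$. So two vectors have the same image, and
their difference is the required solution.\<close>

lemma siegel:
  assumes fin: "finite (carrier R)" and J: "finite J" "card J = Suc M"
    and u: "\<And>j l. j \<in> J \<Longrightarrow> l < M \<Longrightarrow> u j l \<in> polys C"
  shows "\<exists>a. (\<forall>j\<in>J. a j \<in> polys (M * C)) \<and> (\<exists>j\<in>J. a j \<noteq> \<zero>\<^bsub>P\<^esub>) \<and>
     (\<forall>l<M. (\<Oplus>\<^bsub>P\<^esub>j\<in>J. a j \<otimes>\<^bsub>P\<^esub> u j l) = \<zero>\<^bsub>P\<^esub>)"
proof -
  define D where "D = M * C"
  define q where "q = card (carrier R)"
  \<comment> \<open>The linear map whose kernel is sought.\<close>
  define \<Phi> where "\<Phi> a = (\<lambda>l\<in>{..<M}. \<Oplus>\<^bsub>P\<^esub>j\<in>J. a j \<otimes>\<^bsub>P\<^esub> u j l)" for a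
  have q: "q > 1"
  proof -
    have "card {\<zero>, \<one>} \<le> q" unfolding q_def by (intro card_mono fin) auto
    then show ?thesis using R.one_not_zero by (simp add: card_insert_if split: if_splits)
  qed
  have "card (({..<M} \<rightarrow>\<^sub>E polys (D + C))) = q ^ (Suc (D + C) * M)"
    by (simp only: card_PiE finite_lessThan card_polys[OF fin] q_def power_mult prod_constant card_lessThan)
  also have "\<dots> < q ^ (Suc D * Suc M)"
    using q by (intro power_strict_increasing) (auto simp: D_def algebra_simps)
  also have "\<dots> = card (J \<rightarrow>\<^sub>E polys D)"
    using J by (simp only: card_PiE card_polys[OF fin] q_def power_mult prod_constant)
  finally have less: "card ({..<M} \<rightarrow>\<^sub>E polys (D + C)) < card (J \<rightarrow>\<^sub>E polys D)" .
  have maps: "\<Phi> ` (J \<rightarrow>\<^sub>E polys D) \<subseteq> {..<M} \<rightarrow>\<^sub>E polys (D + C)"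
    unfolding \<Phi>_def using u J by (auto intro!: polys_finsum polys_mult)
  have "\<not> inj_on \<Phi> (J \<rightarrow>\<^sub>E polys D)"
  proof
    assume "inj_on \<Phi> (J \<rightarrow>\<^sub>E polys D)"
    then have "card (J \<rightarrow>\<^sub>E polys D) \<le> card ({..<M} \<rightarrow>\<^sub>E polys (D + C))"
      using maps card_polys[OF fin] by (intro card_inj_on_le finite_PiE) auto
    then show False using less by simp
  qed
  then obtain a b where ab: "a \<in> J \<rightarrow>\<^sub>E polys D" "b \<in> J \<rightarrow>\<^sub>E polys D" "a \<noteq> b" "\<Phi> a = \<Phi> b"
    unfolding inj_on_def by blast
  then obtain j where j: "j \<in> J" "a j \<noteq> b j" by (metis PiE_ext)
  have cl: "a j \<in> carrier P" "b j \<in> carrier P" if "j \<in> J" for j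
    using ab that polys_carrier by (auto simp: PiE_iff)
  have ucl: "u j l \<in> carrier P" if "j \<in> J" "l < M" for j l
    using u that polys_carrier by blast
  show ?thesis
  proof (intro exI[of _ "\<lambda>j. a j \<ominus>\<^bsub>P\<^esub> b j"] conjI ballI allI impI)
    fix j assume "j \<in> J"
    then show "a j \<ominus>\<^bsub>P\<^esub> b j \<in> polys (M * C)"
      using ab unfolding D_def by (auto intro!: polys_diff)
  next
    show "\<exists>j\<in>J. a j \<ominus>\<^bsub>P\<^esub> b j \<noteq> \<zero>\<^bsub>P\<^esub>"
      using j cl by (intro bexI[of _ j]) auto
  next
    fix l assume l: "l < M"
    have "(\<Oplus>\<^bsub>P\<^esub>j\<in>J. (a j \<ominus>\<^bsub>P\<^esub> b j) \<otimes>\<^bsub>P\<^esub> u j l)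
        = (\<Oplus>\<^bsub>P\<^esub>j\<in>J. a j \<otimes>\<^bsub>P\<^esub> u j l \<ominus>\<^bsub>P\<^esub> b j \<otimes>\<^bsub>P\<^esub> u j l)"
      using cl ucl l by (intro P.finsum_cong') (auto simp: a_minus_def P.l_distr P.l_minus)
    also have "\<dots> = (\<Oplus>\<^bsub>P\<^esub>j\<in>J. a j \<otimes>\<^bsub>P\<^esub> u j l) \<ominus>\<^bsub>P\<^esub> (\<Oplus>\<^bsub>P\<^esub>j\<in>J. b j \<otimes>\<^bsub>P\<^esub> u j l)"
      using J cl ucl l by (intro P.finsum_diff[symmetric]) auto
    also have "(\<Oplus>\<^bsub>P\<^esub>j\<in>J. a j \<otimes>\<^bsub>P\<^esub> u j l) = (\<Oplus>\<^bsub>P\<^esub>j\<in>J. b j \<otimes>\<^bsub>P\<^esub> u j l)"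
      using fun_cong[OF ab(4), of l] l by (simp add: \<Phi>_def)
    also have "\<dots> \<ominus>\<^bsub>P\<^esub> \<dots> = \<zero>\<^bsub>P\<^esub>"
      using cl ucl l by (simp add: a_minus_def P.r_neg)
    finally show "(\<Oplus>\<^bsub>P\<^esub>j\<in>J. (a j \<ominus>\<^bsub>P\<^esub> b j) \<otimes>\<^bsub>P\<^esub> u j l) = \<zero>\<^bsub>P\<^esub>" .
  qed
qed

text \<open>If the combination of the $l$-th coefficients vanishes for each $l < M$, then only the remainders
$(X - t)^M H_t$ survive.\<close>

lemma vanishing_combination:
  assumes fin: "finite (carrier R)" and J: "finite J" "card J = Suc M"
    and G: "\<And>j. j \<in> J \<Longrightarrow> taylor M C (G j)"
  shows "\<exists>a. (\<forall>j\<in>J. a j \<in> polys (M * C)) \<and> (\<exists>j\<in>J. a j \<noteq> \<zero>\<^bsub>P\<^esub>) \<and>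
     (\<forall>t\<in>carrier R. lin t [^]\<^bsub>P\<^esub> M divides\<^bsub>P\<^esub> (\<Oplus>\<^bsub>P\<^esub>j\<in>J. a j \<otimes>\<^bsub>P\<^esub> G j t))"
proof -
  define Q where "Q j u H \<longleftrightarrow> H 0 = G j \<and> (\<forall>l<M. u l \<in> polys C) \<and>
     (\<forall>l\<le>M. \<forall>t\<in>carrier R. H l t \<in> carrier P) \<and>
     (\<forall>l<M. \<forall>t\<in>carrier R. H l t = u l \<oplus>\<^bsub>P\<^esub> lin t \<otimes>\<^bsub>P\<^esub> H (Suc l) t)" for j u H
  have "\<exists>u H. Q j u H" if "j \<in> J" for j
    unfolding Q_def by (rule taylor_coefficients[OF G[OF that]])
  then obtain u H where Q: "\<And>j. j \<in> J \<Longrightarrow> Q j (u j) (H j)" by metis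
  have H0: "\<And>j. j \<in> J \<Longrightarrow> H j 0 = G j"
    and u: "\<And>j l. j \<in> J \<Longrightarrow> l < M \<Longrightarrow> u j l \<in> polys C"
    and Hc: "\<And>j l t. j \<in> J \<Longrightarrow> l \<le> M \<Longrightarrow> t \<in> carrier R \<Longrightarrow> H j l t \<in> carrier P"
    and HS: "\<And>j l t. j \<in> J \<Longrightarrow> l < M \<Longrightarrow> t \<in> carrier R \<Longrightarrow>
       H j l t = u j l \<oplus>\<^bsub>P\<^esub> lin t \<otimes>\<^bsub>P\<^esub> H j (Suc l) t"
    using Q unfolding Q_def by simp_all
  obtain a where a: "\<forall>j\<in>J. a j \<in> polys (M * C)" "\<exists>j\<in>J. a j \<noteq> \<zero>\<^bsub>P\<^esub>"
     "\<forall>l<M. (\<Oplus>\<^bsub>P\<^esub>j\<in>J. a j \<otimes>\<^bsub>P\<^esub> u j l) = \<zero>\<^bsub>P\<^esub>"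
    using siegel[of J M u C, OF fin J u] by blast
  have ac: "a j \<in> carrier P" if "j \<in> J" for j using a that polys_carrier by blast
  have uc: "u j l \<in> carrier P" if "j \<in> J" "l < M" for j l using u that polys_carrier by blast
  have "lin t [^]\<^bsub>P\<^esub> M divides\<^bsub>P\<^esub> (\<Oplus>\<^bsub>P\<^esub>j\<in>J. a j \<otimes>\<^bsub>P\<^esub> G j t)" if t: "t \<in> carrier R" for t
  proof -
    have "(\<Oplus>\<^bsub>P\<^esub>j\<in>J. a j \<otimes>\<^bsub>P\<^esub> G j t)
       = lin t [^]\<^bsub>P\<^esub> l \<otimes>\<^bsub>P\<^esub> (\<Oplus>\<^bsub>P\<^esub>j\<in>J. a j \<otimes>\<^bsub>P\<^esub> H j l t)" if "l \<le> M" for l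
      using that
    proof (induction l)
      case 0
      have "(\<Oplus>\<^bsub>P\<^esub>j\<in>J. a j \<otimes>\<^bsub>P\<^esub> H j 0 t) \<in> carrier P"
        using ac Hc t by (intro P.finsum_closed) auto
      moreover have "(\<Oplus>\<^bsub>P\<^esub>j\<in>J. a j \<otimes>\<^bsub>P\<^esub> G j t) = (\<Oplus>\<^bsub>P\<^esub>j\<in>J. a j \<otimes>\<^bsub>P\<^esub> H j 0 t)"
        using ac Hc[of _ 0] t H0 by (intro P.finsum_cong') auto
      ultimately show ?case by simp
    next
      case (Suc l)
      define L where "L = lin t"
      define T where "T = (\<Oplus>\<^bsub>P\<^esub>j\<in>J. a j \<otimes>\<^bsub>P\<^esub> H j (Suc l) t)"
      have L: "L \<in> carrier P" unfolding L_def using t by simp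
      have T: "T \<in> carrier P" unfolding T_def using ac Hc t Suc by (intro P.finsum_closed) auto
      have "(\<Oplus>\<^bsub>P\<^esub>j\<in>J. a j \<otimes>\<^bsub>P\<^esub> H j l t)
          = (\<Oplus>\<^bsub>P\<^esub>j\<in>J. a j \<otimes>\<^bsub>P\<^esub> u j l \<oplus>\<^bsub>P\<^esub> L \<otimes>\<^bsub>P\<^esub> (a j \<otimes>\<^bsub>P\<^esub> H j (Suc l) t))"
        using ac uc Hc[of _ "Suc l"] t Suc HS[of _ l t] L unfolding L_def
        by (intro P.finsum_cong') (auto simp: P.r_distr P.m_lcomm)
      also have "\<dots> = (\<Oplus>\<^bsub>P\<^esub>j\<in>J. a j \<otimes>\<^bsub>P\<^esub> u j l) \<oplus>\<^bsub>P\<^esub> (\<Oplus>\<^bsub>P\<^esub>j\<in>J. L \<otimes>\<^bsub>P\<^esub> (a j \<otimes>\<^bsub>P\<^esub> H j (Suc l) t))"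
        using ac uc Hc t Suc L by (intro P.finsum_addf) auto
      also have "(\<Oplus>\<^bsub>P\<^esub>j\<in>J. L \<otimes>\<^bsub>P\<^esub> (a j \<otimes>\<^bsub>P\<^esub> H j (Suc l) t)) = L \<otimes>\<^bsub>P\<^esub> T"
        unfolding T_def using ac Hc t Suc L J by (intro P.finsum_rdistr[symmetric]) auto
      also have "(\<Oplus>\<^bsub>P\<^esub>j\<in>J. a j \<otimes>\<^bsub>P\<^esub> u j l) = \<zero>\<^bsub>P\<^esub>" using a Suc by simp
      finally have "(\<Oplus>\<^bsub>P\<^esub>j\<in>J. a j \<otimes>\<^bsub>P\<^esub> H j l t) = L \<otimes>\<^bsub>P\<^esub> T" using L T by simp
      then show ?case using Suc L T unfolding T_def[symmetric] L_def[symmetric] by (simp add: P.m_assoc)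
    qed
    moreover have "(\<Oplus>\<^bsub>P\<^esub>j\<in>J. a j \<otimes>\<^bsub>P\<^esub> H j M t) \<in> carrier P"
      using ac Hc t by (intro P.finsum_closed) auto
    ultimately show ?thesis by (intro dividesI[of "\<Oplus>\<^bsub>P\<^esub>j\<in>J. a j \<otimes>\<^bsub>P\<^esub> H j M t"]) auto
  qed
  then show ?thesis using a by blast
qed

end

section \<open>Stepanov's method\<close>

locale odd_finite_field = UP R P + R?: field R for R (structure) and P (structure) +
  assumes odd_order: "odd (order R)" and primepow_order: "primepow (order R)"

sublocale odd_finite_field < UP_domain R P ..

context odd_finite_field
begin

abbreviation "q \<equiv> order R"
definition half :: nat where
  "half = (q - 1) div 2"

lemma q_eq: "q = 2 * half + 1"
  using odd_order unfolding half_def by (elim oddE) simp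

lemma finite_carrier: "finite (carrier R)"
  using primepow_order primepow_gt_0_nat[of q] by (auto simp: order_def card_ge_0_finite)

lemma half_pos: "0 < half"
  using primepow_gt_Suc_0[OF primepow_order] q_eq by auto

text \<open>Lagrange's theorem in the multiplicative group of order $q - 1$.\<close>

lemma pow_q:
  assumes "x \<in> carrier R"
  shows "x [^] q = x"
proof (cases "x = \<zero>")
  case True
  then show ?thesis using q_eq by (simp add: nat_pow_zero)
next
  case False
  interpret mult_of: group "Multiplicative_Group.mult_of R" by (rule field_mult_group)
  have "x [^] order (Multiplicative_Group.mult_of R) = \<one>"
    using mult_of.pow_order_eq_1[of x] assms False by (simp add: Multiplicative_Group.nat_pow_mult_of)
  then have "x [^] (2 * half) = \<one>" by (simp add: order_mult_of[OF finite_carrier] q_eq)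
  then have "x [^] Suc (2 * half) = x" using assms by simp
  then show ?thesis by (simp add: q_eq)
qed

lemma of_nat_q: "\<guillemotleft>q\<guillemotright>\<^sub>\<nat> = \<zero>"
proof -
  have "\<guillemotleft>m\<guillemotright>\<^sub>\<nat> = add_pow R m \<one>" for m
    by (induction m) (simp_all add: R.a_comm)
  moreover have "add_pow R (order (add_monoid R)) \<one> = \<zero>"
    using R.add.pow_order_eq_1[of \<one>] by (simp add: add_pow_def)
  ultimately show ?thesis by (simp add: order_def)
qed

lemma prime_char:
  obtains p s where "Factorial_Ring.prime p" "q = p ^ s" "\<guillemotleft>p\<guillemotright>\<^sub>\<nat>\<^bsub>P\<^esub> = \<zero>\<^bsub>P\<^esub>"
proof -
  obtain p s where p: "Factorial_Ring.prime p" "q = p ^ s"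
    using primepow_order by (auto simp: primepow_def)
  have "\<guillemotleft>p ^ s\<guillemotright>\<^sub>\<nat> = \<guillemotleft>p\<guillemotright>\<^sub>\<nat> [^] s"
    by (induction s) (simp_all add: R.m_comm)
  then have "\<guillemotleft>p\<guillemotright>\<^sub>\<nat> = \<zero>"
    using of_nat_q p R_pow_nonzero[of "\<guillemotleft>p\<guillemotright>\<^sub>\<nat>" s] by auto
  then have "\<guillemotleft>p\<guillemotright>\<^sub>\<nat>\<^bsub>P\<^esub> = \<zero>\<^bsub>P\<^esub>"
    using const_of_nat[of p] by simp
  then show ?thesis using that p by blast
qed

text \<open>$X^q - t = (X - t)^q$, by the Frobenius identity for $X = t + (X - t)$ and $t^q = t$. The Frobenius
identity carries a factor $t^M$, which is cancelled for $t \neq 0$; the case $t = 0$ is immediate.\<close>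

lemma lin_power_divides_frobenius:
  assumes "0 < M" "M \<le> q" and t: "t \<in> carrier R"
  shows "lin t [^]\<^bsub>P\<^esub> M divides\<^bsub>P\<^esub> (indet [^]\<^bsub>P\<^esub> q \<ominus>\<^bsub>P\<^esub> const t)"
proof (cases "t = \<zero>")
  case True
  have "indet [^]\<^bsub>P\<^esub> q = indet [^]\<^bsub>P\<^esub> M \<otimes>\<^bsub>P\<^esub> indet [^]\<^bsub>P\<^esub> (q - M)"
    using assms by (subst P.nat_pow_mult) auto
  moreover have "indet [^]\<^bsub>P\<^esub> (q - M) \<in> carrier P" by simp
  ultimately show ?thesis using True by (auto simp: lin_def a_minus_def factor_def simp del: One_nat_def)
next
  case False
  obtain p s where p: "Factorial_Ring.prime p" "q = p ^ s" "\<guillemotleft>p\<guillemotright>\<^sub>\<nat>\<^bsub>P\<^esub> = \<zero>\<^bsub>P\<^esub>"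
    by (rule prime_char)
  define e d where "e = const t" and "d = lin t"
  have ed: "e \<in> carrier P" "d \<in> carrier P" using t by (auto simp: e_def d_def)
  obtain u where u: "u \<in> carrier P"
    "(e \<oplus>\<^bsub>P\<^esub> d) [^]\<^bsub>P\<^esub> q \<otimes>\<^bsub>P\<^esub> e [^]\<^bsub>P\<^esub> M = e [^]\<^bsub>P\<^esub> q \<otimes>\<^bsub>P\<^esub> e [^]\<^bsub>P\<^esub> M \<oplus>\<^bsub>P\<^esub> d [^]\<^bsub>P\<^esub> M \<otimes>\<^bsub>P\<^esub> u"
    using P.frobenius_mod_power[OF p(1,3) assms(1) _ ed, of s] assms(2) p(2) by auto
  have cancel: "e \<oplus>\<^bsub>P\<^esub> (x \<ominus>\<^bsub>P\<^esub> e) = x" if "x \<in> carrier P" for x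
    using that ed by (simp add: a_minus_def P.a_comm[of x] P.r_neg2)
  have "indet = e \<oplus>\<^bsub>P\<^esub> d"
    unfolding d_def lin_def e_def[symmetric] by (rule cancel[symmetric]) simp
  moreover have eq: "e [^]\<^bsub>P\<^esub> q = e" unfolding e_def using t by (simp add: const_pow[symmetric] pow_q)
  define Y E D where "Y = indet [^]\<^bsub>P\<^esub> q" and "E = e [^]\<^bsub>P\<^esub> M" and "D = d [^]\<^bsub>P\<^esub> M"
  have cl: "Y \<in> carrier P" "E \<in> carrier P" "D \<in> carrier P" using ed unfolding Y_def E_def D_def by auto
  have "Y \<otimes>\<^bsub>P\<^esub> E = e \<otimes>\<^bsub>P\<^esub> E \<oplus>\<^bsub>P\<^esub> D \<otimes>\<^bsub>P\<^esub> u"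
    using u(2) unfolding Y_def E_def D_def eq calculation[symmetric] .
  then have "E \<otimes>\<^bsub>P\<^esub> (Y \<ominus>\<^bsub>P\<^esub> e) = D \<otimes>\<^bsub>P\<^esub> u"
    using cl ed u(1)
    by (simp add: a_minus_def P.r_distr P.r_minus P.m_comm[of E] P.a_comm[of "e \<otimes>\<^bsub>P\<^esub> E"] P.a_assoc P.r_neg)
  moreover have "ev t E \<noteq> \<zero>"
    unfolding E_def e_def using t False by (simp add: ev_pow ev_simps R_pow_nonzero)
  ultimately show ?thesis
    using lin_power_cancel[of t M E "Y \<ominus>\<^bsub>P\<^esub> e"] cl ed u(1) t
    unfolding D_def d_def e_def[symmetric] Y_def[symmetric] by (auto simp: factor_def)
qed

text \<open>The polynomial $f^q - 1$ is $(f - 1)^q$, and $X$ divides $f - 1$.\<close>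

lemma poly_power_q:
  assumes f: "f \<in> carrier P" and f0: "ev \<zero> f = \<one>"
  shows "\<exists>v\<in>carrier P. f [^]\<^bsub>P\<^esub> q = \<one>\<^bsub>P\<^esub> \<oplus>\<^bsub>P\<^esub> indet [^]\<^bsub>P\<^esub> q \<otimes>\<^bsub>P\<^esub> v"
proof -
  obtain p s where p: "Factorial_Ring.prime p" "q = p ^ s" "\<guillemotleft>p\<guillemotright>\<^sub>\<nat>\<^bsub>P\<^esub> = \<zero>\<^bsub>P\<^esub>"
    by (rule prime_char)
  obtain f' where f': "f' \<in> carrier P" "f = lin \<zero> \<otimes>\<^bsub>P\<^esub> f' \<oplus>\<^bsub>P\<^esub> const (ev \<zero> f)"
    using remainder_at[OF f R.zero_closed] by blast
  have lin0: "lin \<zero> = indet" by (simp add: lin_def a_minus_def del: One_nat_def)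
  have eq: "f = \<one>\<^bsub>P\<^esub> \<oplus>\<^bsub>P\<^esub> indet \<otimes>\<^bsub>P\<^esub> f'"
    using f' f0 lin0 by (simp add: P.a_comm del: One_nat_def)
  obtain u where u: "u \<in> carrier P" "(\<one>\<^bsub>P\<^esub> \<oplus>\<^bsub>P\<^esub> indet \<otimes>\<^bsub>P\<^esub> f') [^]\<^bsub>P\<^esub> q = \<one>\<^bsub>P\<^esub> \<oplus>\<^bsub>P\<^esub> (indet \<otimes>\<^bsub>P\<^esub> f') [^]\<^bsub>P\<^esub> q \<otimes>\<^bsub>P\<^esub> u"
    using P.frobenius_mod_power[OF p(1,3) _ _ P.one_closed, of q s "indet \<otimes>\<^bsub>P\<^esub> f'", folded p(2)] f' q_eq
    by (auto simp del: One_nat_def)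
  have "(indet \<otimes>\<^bsub>P\<^esub> f') [^]\<^bsub>P\<^esub> q \<otimes>\<^bsub>P\<^esub> u = indet [^]\<^bsub>P\<^esub> q \<otimes>\<^bsub>P\<^esub> (f' [^]\<^bsub>P\<^esub> q \<otimes>\<^bsub>P\<^esub> u)"
    using u f' by (simp add: P.nat_pow_distrib P.m_assoc del: One_nat_def)
  then show ?thesis using u f' unfolding eq[symmetric] by (intro bexI[of _ "f' [^]\<^bsub>P\<^esub> q \<otimes>\<^bsub>P\<^esub> u"]) auto
qed

lemma deg_indet_pow: "UnivPoly.deg R (indet [^]\<^bsub>P\<^esub> (m::nat)) = m"
  by (simp add: monom_pow del: One_nat_def)

lemma indet_pow_multiple_eq_zero:
  assumes "p \<in> polys d" "d < m" "w \<in> carrier P" "p = indet [^]\<^bsub>P\<^esub> (m::nat) \<otimes>\<^bsub>P\<^esub> w"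
  shows "p = \<zero>\<^bsub>P\<^esub>"
proof (rule ccontr)
  assume "p \<noteq> \<zero>\<^bsub>P\<^esub>"
  then have "w \<noteq> \<zero>\<^bsub>P\<^esub>" using assms by auto
  moreover have "indet [^]\<^bsub>P\<^esub> m \<noteq> \<zero>\<^bsub>P\<^esub>"
    using deg_indet_pow[of m] assms(2) deg_zero by (metis not_less_zero)
  ultimately have "UnivPoly.deg R p = m + UnivPoly.deg R w"
    unfolding assms(4) using assms(3) by (subst deg_mult) (auto simp: deg_indet_pow simp del: One_nat_def)
  then show False using assms(1,2) by (simp add: polys_def)
qed

text \<open>Infinite descent at the simple root $t$ of $f = (X - t) f_1$. If $f a^2 = b^2$, then $X - t$ divides $b$,
hence also $a$, and the quotients satisfy the same equation. Equivalently, the order of vanishing at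
$t$ is odd on one side and even on the other.\<close>

lemma square_mult_simple_root:
  assumes f1: "f1 \<in> carrier P" "t \<in> carrier R" "ev t f1 \<noteq> \<zero>"
    and "a \<in> carrier P" "b \<in> carrier P" "(lin t \<otimes>\<^bsub>P\<^esub> f1) \<otimes>\<^bsub>P\<^esub> (a \<otimes>\<^bsub>P\<^esub> a) = b \<otimes>\<^bsub>P\<^esub> b"
  shows "a = \<zero>\<^bsub>P\<^esub>"
  using assms(4-)
proof (induction "UnivPoly.deg R a" arbitrary: a b rule: less_induct)
  case less
  define l where "l = lin t"
  have l: "l \<in> carrier P" "l \<noteq> \<zero>\<^bsub>P\<^esub>" "ev t l = \<zero>"
    unfolding l_def using f1 lin_nonzero by (auto simp: ev_lin a_minus_def R.r_neg)
  note cl = l(1) f1(1) less.prems(1,2)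
  have eq: "l \<otimes>\<^bsub>P\<^esub> f1 \<otimes>\<^bsub>P\<^esub> (a \<otimes>\<^bsub>P\<^esub> a) = b \<otimes>\<^bsub>P\<^esub> b" using less.prems l_def by simp
  have "ev t b \<otimes> ev t b = ev t (l \<otimes>\<^bsub>P\<^esub> f1 \<otimes>\<^bsub>P\<^esub> (a \<otimes>\<^bsub>P\<^esub> a))"
    unfolding eq using cl f1(2) by (simp add: ev_simps)
  also have "\<dots> = \<zero>" using cl f1(2) l(3) by (simp add: ev_simps)
  finally have evb: "ev t b = \<zero>" using cl f1(2) by (simp add: R.integral_iff)
  then obtain b' where b': "b' \<in> carrier P" "b = l \<otimes>\<^bsub>P\<^esub> b'"
    using root_factor[OF cl(4) f1(2) evb] unfolding l_def by blast
  have "l \<otimes>\<^bsub>P\<^esub> (f1 \<otimes>\<^bsub>P\<^esub> (a \<otimes>\<^bsub>P\<^esub> a)) = l \<otimes>\<^bsub>P\<^esub> (l \<otimes>\<^bsub>P\<^esub> (b' \<otimes>\<^bsub>P\<^esub> b'))"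
    using eq cl b' by (simp add: P.m_ac)
  then have eq2: "f1 \<otimes>\<^bsub>P\<^esub> (a \<otimes>\<^bsub>P\<^esub> a) = l \<otimes>\<^bsub>P\<^esub> (b' \<otimes>\<^bsub>P\<^esub> b')"
    using l(2) cl b' by (simp add: m_lcancel)
  have "ev t f1 \<otimes> (ev t a \<otimes> ev t a) = ev t (l \<otimes>\<^bsub>P\<^esub> (b' \<otimes>\<^bsub>P\<^esub> b'))"
    unfolding eq2[symmetric] using cl f1(2) by (simp add: ev_simps)
  also have "\<dots> = \<zero>" using cl f1(2) l(3) b' by (simp add: ev_simps)
  finally have eva: "ev t a = \<zero>" using cl f1(2,3) by (simp add: R.integral_iff)
  then obtain a' where a': "a' \<in> carrier P" "a = l \<otimes>\<^bsub>P\<^esub> a'"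
      and deg: "a' = \<zero>\<^bsub>P\<^esub> \<or> UnivPoly.deg R a = Suc (UnivPoly.deg R a')"
    using root_factor[OF cl(3) f1(2) eva] unfolding l_def by blast
  have "l \<otimes>\<^bsub>P\<^esub> (l \<otimes>\<^bsub>P\<^esub> f1 \<otimes>\<^bsub>P\<^esub> (a' \<otimes>\<^bsub>P\<^esub> a')) = l \<otimes>\<^bsub>P\<^esub> (b' \<otimes>\<^bsub>P\<^esub> b')"
    using eq2 a' cl by (simp add: P.m_ac)
  then have "l \<otimes>\<^bsub>P\<^esub> f1 \<otimes>\<^bsub>P\<^esub> (a' \<otimes>\<^bsub>P\<^esub> a') = b' \<otimes>\<^bsub>P\<^esub> b'"
    using l(2) cl b' a' by (simp add: m_lcancel)
  then have "a' = \<zero>\<^bsub>P\<^esub>"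
    using less.hyps[of a' b'] deg a' b' unfolding l_def by auto
  then show ?case using a' cl by simp
qed

text \<open>With $U = a + X^q A$ and $V = b + X^q B$ the relation reads $U = - g V$, so that
$f U^2 = f g^2 V^2 = f^q V^2$, because $f g^2 = f^q$. Modulo $X^q$ the factor $f^q$ is $1$, and $U$, $V$
reduce to $a$, $b$. So $X^q$ divides $f a^2 - b^2$, which has degree less than $q$ and therefore
vanishes. The simple root of $f$ then forces $a = b = 0$.\<close>

lemma linear_relation_mod_frobenius:
  assumes f: "f \<in> polys r" "ev \<zero> f = \<one>"
    and root: "f = lin t0 \<otimes>\<^bsub>P\<^esub> f1" "f1 \<in> carrier P" "t0 \<in> carrier R" "ev t0 f1 \<noteq> \<zero>"
    and ab: "a \<in> polys D" "b \<in> polys D" and small: "r + 2 * D < q"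
    and AB: "A \<in> carrier P" "B \<in> carrier P"
    and rel: "(a \<oplus>\<^bsub>P\<^esub> indet [^]\<^bsub>P\<^esub> q \<otimes>\<^bsub>P\<^esub> A) \<oplus>\<^bsub>P\<^esub> f [^]\<^bsub>P\<^esub> half \<otimes>\<^bsub>P\<^esub> (b \<oplus>\<^bsub>P\<^esub> indet [^]\<^bsub>P\<^esub> q \<otimes>\<^bsub>P\<^esub> B) = \<zero>\<^bsub>P\<^esub>"
  shows "a = \<zero>\<^bsub>P\<^esub> \<and> b = \<zero>\<^bsub>P\<^esub>"
proof -
  define Y g where "Y = indet [^]\<^bsub>P\<^esub> q" and "g = f [^]\<^bsub>P\<^esub> half"
  have fc: "f \<in> carrier P" using f polys_carrier by blast
  have cl: "a \<in> carrier P" "b \<in> carrier P" "A \<in> carrier P" "B \<in> carrier P" "f \<in> carrier P"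
      "Y \<in> carrier P" "g \<in> carrier P"
    using ab AB fc polys_carrier by (auto simp: Y_def g_def)
  obtain v where v: "v \<in> carrier P" "f [^]\<^bsub>P\<^esub> q = \<one>\<^bsub>P\<^esub> \<oplus>\<^bsub>P\<^esub> Y \<otimes>\<^bsub>P\<^esub> v"
    using poly_power_q[OF fc f(2)] unfolding Y_def by blast
  have "f [^]\<^bsub>P\<^esub> q = f [^]\<^bsub>P\<^esub> (half + half + 1)" by (simp add: q_eq mult_2)
  also have "\<dots> = g \<otimes>\<^bsub>P\<^esub> g \<otimes>\<^bsub>P\<^esub> f"
    using fc by (simp add: g_def P.nat_pow_mult[symmetric])
  finally have gg: "g \<otimes>\<^bsub>P\<^esub> g \<otimes>\<^bsub>P\<^esub> f = \<one>\<^bsub>P\<^esub> \<oplus>\<^bsub>P\<^esub> Y \<otimes>\<^bsub>P\<^esub> v" using v(2) by simp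
  define V where "V = b \<oplus>\<^bsub>P\<^esub> Y \<otimes>\<^bsub>P\<^esub> B"
  define U where "U = a \<oplus>\<^bsub>P\<^esub> Y \<otimes>\<^bsub>P\<^esub> A"
  have UV: "U \<in> carrier P" "V \<in> carrier P" using cl by (auto simp: U_def V_def)
  have "U \<oplus>\<^bsub>P\<^esub> g \<otimes>\<^bsub>P\<^esub> V = \<zero>\<^bsub>P\<^esub>" using rel by (simp add: U_def V_def Y_def g_def)
  then have "U = \<ominus>\<^bsub>P\<^esub> (g \<otimes>\<^bsub>P\<^esub> V)" using cl UV by (intro P.minus_equality[symmetric]) (auto simp: P.a_comm)
  then have "f \<otimes>\<^bsub>P\<^esub> (U \<otimes>\<^bsub>P\<^esub> U) = (g \<otimes>\<^bsub>P\<^esub> g \<otimes>\<^bsub>P\<^esub> f) \<otimes>\<^bsub>P\<^esub> (V \<otimes>\<^bsub>P\<^esub> V)"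
    using cl UV by (simp add: P.l_minus P.r_minus P.m_ac)
  then have main: "f \<otimes>\<^bsub>P\<^esub> (U \<otimes>\<^bsub>P\<^esub> U) = (\<one>\<^bsub>P\<^esub> \<oplus>\<^bsub>P\<^esub> Y \<otimes>\<^bsub>P\<^esub> v) \<otimes>\<^bsub>P\<^esub> (V \<otimes>\<^bsub>P\<^esub> V)"
    unfolding gg .
  define U' V' where "U' = A \<otimes>\<^bsub>P\<^esub> U \<oplus>\<^bsub>P\<^esub> a \<otimes>\<^bsub>P\<^esub> A" and "V' = B \<otimes>\<^bsub>P\<^esub> V \<oplus>\<^bsub>P\<^esub> b \<otimes>\<^bsub>P\<^esub> B"
  have UV': "U' \<in> carrier P" "V' \<in> carrier P" using cl UV by (simp_all add: U'_def V'_def)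
  have UU: "U \<otimes>\<^bsub>P\<^esub> U = a \<otimes>\<^bsub>P\<^esub> a \<oplus>\<^bsub>P\<^esub> Y \<otimes>\<^bsub>P\<^esub> U'" unfolding U_def U'_def using cl by (intro P.square_expansion)
  have VV: "V \<otimes>\<^bsub>P\<^esub> V = b \<otimes>\<^bsub>P\<^esub> b \<oplus>\<^bsub>P\<^esub> Y \<otimes>\<^bsub>P\<^esub> V'" unfolding V_def V'_def using cl by (intro P.square_expansion)
  define T where "T = (V' \<oplus>\<^bsub>P\<^esub> v \<otimes>\<^bsub>P\<^esub> (V \<otimes>\<^bsub>P\<^esub> V)) \<ominus>\<^bsub>P\<^esub> f \<otimes>\<^bsub>P\<^esub> U'"
  have T: "T \<in> carrier P" unfolding T_def using cl UV UV' v by simp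
  have "f \<otimes>\<^bsub>P\<^esub> (a \<otimes>\<^bsub>P\<^esub> a) \<oplus>\<^bsub>P\<^esub> Y \<otimes>\<^bsub>P\<^esub> (f \<otimes>\<^bsub>P\<^esub> U') = f \<otimes>\<^bsub>P\<^esub> (U \<otimes>\<^bsub>P\<^esub> U)"
    unfolding UU using cl UV' by (simp add: P.r_distr P.m_lcomm)
  also have "\<dots> = V \<otimes>\<^bsub>P\<^esub> V \<oplus>\<^bsub>P\<^esub> Y \<otimes>\<^bsub>P\<^esub> (v \<otimes>\<^bsub>P\<^esub> (V \<otimes>\<^bsub>P\<^esub> V))"
    unfolding main using cl UV v by (simp add: P.l_distr P.m_assoc)
  also have "\<dots> = (b \<otimes>\<^bsub>P\<^esub> b \<oplus>\<^bsub>P\<^esub> Y \<otimes>\<^bsub>P\<^esub> V') \<oplus>\<^bsub>P\<^esub> Y \<otimes>\<^bsub>P\<^esub> (v \<otimes>\<^bsub>P\<^esub> (V \<otimes>\<^bsub>P\<^esub> V))"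
    by (subst (1) VV) (rule refl)
  also have "\<dots> = b \<otimes>\<^bsub>P\<^esub> b \<oplus>\<^bsub>P\<^esub> Y \<otimes>\<^bsub>P\<^esub> (V' \<oplus>\<^bsub>P\<^esub> v \<otimes>\<^bsub>P\<^esub> (V \<otimes>\<^bsub>P\<^esub> V))"
    using cl UV UV' v by (simp add: P.r_distr P.a_assoc)
  finally have eq: "f \<otimes>\<^bsub>P\<^esub> (a \<otimes>\<^bsub>P\<^esub> a) \<ominus>\<^bsub>P\<^esub> b \<otimes>\<^bsub>P\<^esub> b = Y \<otimes>\<^bsub>P\<^esub> T"
    unfolding T_def using cl UV UV' v by (intro P.diff_eq_multiple) auto
  have "f \<otimes>\<^bsub>P\<^esub> (a \<otimes>\<^bsub>P\<^esub> a) \<ominus>\<^bsub>P\<^esub> b \<otimes>\<^bsub>P\<^esub> b \<in> polys (r + 2 * D)"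
    using polys_mult[OF f(1) polys_mult[OF ab(1,1)]] polys_mult[OF ab(2,2)]
    by (intro polys_diff) (auto simp: mult_2 intro: polys_mono)
  then have "f \<otimes>\<^bsub>P\<^esub> (a \<otimes>\<^bsub>P\<^esub> a) \<ominus>\<^bsub>P\<^esub> b \<otimes>\<^bsub>P\<^esub> b = \<zero>\<^bsub>P\<^esub>"
    using indet_pow_multiple_eq_zero[OF _ small T eq[unfolded Y_def]] by blast
  then have sq: "f \<otimes>\<^bsub>P\<^esub> (a \<otimes>\<^bsub>P\<^esub> a) = b \<otimes>\<^bsub>P\<^esub> b" using cl by simp
  then have a0: "a = \<zero>\<^bsub>P\<^esub>"
    using square_mult_simple_root[OF root(2,3,4) cl(1,2)] unfolding root(1) by blast
  have "b \<otimes>\<^bsub>P\<^esub> b = \<zero>\<^bsub>P\<^esub>" using sq cl(5) unfolding a0 by simp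
  then have "b = \<zero>\<^bsub>P\<^esub>" using integral_iff[OF cl(2,2)] by blast
  then show ?thesis using a0 by blast
qed

text \<open>The lowest coefficients $a_0$, $b_0$ vanish by the previous lemma. Division by $X^q$ then leaves a
relation of the same shape with one term less.\<close>

lemma auxiliary_polynomial_nonzero:
  fixes k i :: nat
  assumes f: "f \<in> polys r" "ev \<zero> f = \<one>"
    and root: "f = lin t0 \<otimes>\<^bsub>P\<^esub> f1" "f1 \<in> carrier P" "t0 \<in> carrier R" "ev t0 f1 \<noteq> \<zero>"
    and small: "r + 2 * D < q"
  shows "(\<And>i. i \<le> k \<Longrightarrow> a i \<in> polys D) \<Longrightarrow> (\<And>i. i \<le> k \<Longrightarrow> b i \<in> polys D) \<Longrightarrow>
    (\<Oplus>\<^bsub>P\<^esub>i\<in>{..k}. a i \<otimes>\<^bsub>P\<^esub> (indet [^]\<^bsub>P\<^esub> q) [^]\<^bsub>P\<^esub> i) \<oplus>\<^bsub>P\<^esub>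
    f [^]\<^bsub>P\<^esub> half \<otimes>\<^bsub>P\<^esub> (\<Oplus>\<^bsub>P\<^esub>i\<in>{..k}. b i \<otimes>\<^bsub>P\<^esub> (indet [^]\<^bsub>P\<^esub> q) [^]\<^bsub>P\<^esub> i) = \<zero>\<^bsub>P\<^esub> \<Longrightarrow>
    i \<le> k \<Longrightarrow> a i = \<zero>\<^bsub>P\<^esub> \<and> b i = \<zero>\<^bsub>P\<^esub>"
proof (induction k arbitrary: a b i)
  case 0
  have "a 0 \<in> polys D" "b 0 \<in> polys D" using 0 by auto
  moreover from this have "a 0 \<in> carrier P" "b 0 \<in> carrier P" using polys_carrier by auto
  ultimately show ?case
    using 0(3,4) linear_relation_mod_frobenius[OF f root _ _ small P.zero_closed P.zero_closed, of "a 0" "b 0"]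
    by simp
next
  case (Suc k)
  define Y where "Y = indet [^]\<^bsub>P\<^esub> q"
  have "UnivPoly.deg R Y \<noteq> 0" unfolding Y_def deg_indet_pow using q_eq by simp
  then have Y: "Y \<in> carrier P" "Y \<noteq> \<zero>\<^bsub>P\<^esub>"
    using deg_nzero_nzero by (auto simp: Y_def simp del: One_nat_def)
  define S where "S c = (\<Oplus>\<^bsub>P\<^esub>i\<in>{..k}. c (Suc i) \<otimes>\<^bsub>P\<^esub> Y [^]\<^bsub>P\<^esub> i)" for c
  have split: "(\<Oplus>\<^bsub>P\<^esub>i\<in>{..Suc k}. c i \<otimes>\<^bsub>P\<^esub> Y [^]\<^bsub>P\<^esub> i) = c 0 \<oplus>\<^bsub>P\<^esub> Y \<otimes>\<^bsub>P\<^esub> S c" and Sc: "S c \<in> carrier P"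
    if c: "\<And>i. i \<le> Suc k \<Longrightarrow> c i \<in> polys D" for c
  proof -
    have cc: "c i \<in> carrier P" if "i \<le> Suc k" for i using c that polys_carrier by blast
    show Sc: "S c \<in> carrier P" unfolding S_def using cc Y by (intro P.finsum_closed) auto
    have "Y \<otimes>\<^bsub>P\<^esub> S c = (\<Oplus>\<^bsub>P\<^esub>i\<in>{..k}. Y \<otimes>\<^bsub>P\<^esub> (c (Suc i) \<otimes>\<^bsub>P\<^esub> Y [^]\<^bsub>P\<^esub> i))"
      unfolding S_def using cc Y by (intro P.finsum_rdistr) auto
    also have "\<dots> = (\<Oplus>\<^bsub>P\<^esub>i\<in>{..k}. c (Suc i) \<otimes>\<^bsub>P\<^esub> Y [^]\<^bsub>P\<^esub> Suc i)"
      using cc Y by (intro P.finsum_cong') (auto simp: P.m_ac)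
    finally have "Y \<otimes>\<^bsub>P\<^esub> S c = (\<Oplus>\<^bsub>P\<^esub>i\<in>{..k}. c (Suc i) \<otimes>\<^bsub>P\<^esub> Y [^]\<^bsub>P\<^esub> Suc i)" .
    moreover have "(\<Oplus>\<^bsub>P\<^esub>i\<in>{..Suc k}. c i \<otimes>\<^bsub>P\<^esub> Y [^]\<^bsub>P\<^esub> i)
       = (\<Oplus>\<^bsub>P\<^esub>i\<in>{..k}. c (Suc i) \<otimes>\<^bsub>P\<^esub> Y [^]\<^bsub>P\<^esub> Suc i) \<oplus>\<^bsub>P\<^esub> c 0 \<otimes>\<^bsub>P\<^esub> Y [^]\<^bsub>P\<^esub> (0::nat)"
      using cc Y by (intro P.finsum_Suc2) auto
    ultimately have "(\<Oplus>\<^bsub>P\<^esub>i\<in>{..Suc k}. c i \<otimes>\<^bsub>P\<^esub> Y [^]\<^bsub>P\<^esub> i)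
       = Y \<otimes>\<^bsub>P\<^esub> S c \<oplus>\<^bsub>P\<^esub> c 0 \<otimes>\<^bsub>P\<^esub> Y [^]\<^bsub>P\<^esub> (0::nat)" by (simp only:)
    then show "(\<Oplus>\<^bsub>P\<^esub>i\<in>{..Suc k}. c i \<otimes>\<^bsub>P\<^esub> Y [^]\<^bsub>P\<^esub> i) = c 0 \<oplus>\<^bsub>P\<^esub> Y \<otimes>\<^bsub>P\<^esub> S c"
      using cc[of 0] Y Sc P.a_comm[of "Y \<otimes>\<^bsub>P\<^esub> S c" "c 0"] by simp
  qed
  define g where "g = f [^]\<^bsub>P\<^esub> half"
  have g: "g \<in> carrier P" unfolding g_def using f polys_carrier by auto
  have cl: "a 0 \<in> carrier P" "b 0 \<in> carrier P" "S a \<in> carrier P" "S b \<in> carrier P"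
    using Suc.prems(1,2)[of 0] polys_carrier Sc[OF Suc.prems(1)] Sc[OF Suc.prems(2)] by auto
  have rel: "(a 0 \<oplus>\<^bsub>P\<^esub> Y \<otimes>\<^bsub>P\<^esub> S a) \<oplus>\<^bsub>P\<^esub> g \<otimes>\<^bsub>P\<^esub> (b 0 \<oplus>\<^bsub>P\<^esub> Y \<otimes>\<^bsub>P\<^esub> S b) = \<zero>\<^bsub>P\<^esub>"
    using Suc.prems(3) split[of a] split[of b] Suc.prems(1,2)
    unfolding Y_def[symmetric] g_def[symmetric] by simp
  then have zero: "a 0 = \<zero>\<^bsub>P\<^esub>" "b 0 = \<zero>\<^bsub>P\<^esub>"
    using linear_relation_mod_frobenius[OF f root _ _ small cl(3,4), of "a 0" "b 0"] Suc.prems(1,2)[of 0]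
    unfolding Y_def g_def by auto
  then have "Y \<otimes>\<^bsub>P\<^esub> (S a \<oplus>\<^bsub>P\<^esub> g \<otimes>\<^bsub>P\<^esub> S b) = \<zero>\<^bsub>P\<^esub>"
    using rel Y cl g by (simp add: P.r_distr P.m_lcomm)
  then have "S a \<oplus>\<^bsub>P\<^esub> g \<otimes>\<^bsub>P\<^esub> S b = \<zero>\<^bsub>P\<^esub>"
    using Y cl g by (simp add: integral_iff)
  then have IH: "a (Suc i) = \<zero>\<^bsub>P\<^esub> \<and> b (Suc i) = \<zero>\<^bsub>P\<^esub>" if "i \<le> k" for i
    using Suc.IH[of "\<lambda>i. a (Suc i)" "\<lambda>i. b (Suc i)" i] Suc.prems(1,2) that
    unfolding S_def Y_def g_def by auto
  show ?case
    using zero IH[of "i - 1"] Suc.prems(4) by (cases i) auto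
qed

lemma taylor_trunc_binomial:
  assumes "taylor N r e" "taylor N r d"
  shows "taylor N (r * M) (\<lambda>t. P.trunc_binomial j (e t) (d t) M)"
proof (induction M)
  case 0
  then show ?case by (simp add: taylor_poly polys_zero)
next
  case (Suc M)
  have c: "\<guillemotleft>j choose M\<guillemotright>\<^sub>\<nat>\<^bsub>P\<^esub> \<in> polys 0"
    by (subst const_of_nat[symmetric]) (simp add: polys_const)
  have "taylor N (0 + (r + r * M)) (\<lambda>t. \<guillemotleft>j choose M\<guillemotright>\<^sub>\<nat>\<^bsub>P\<^esub> \<otimes>\<^bsub>P\<^esub> (e t \<otimes>\<^bsub>P\<^esub> d t [^]\<^bsub>P\<^esub> M))"
    by (intro taylor_mult_poly[OF c] taylor_mult taylor_pow assms)
  moreover have "taylor N (r + r * M) (\<lambda>t. e t \<otimes>\<^bsub>P\<^esub> P.trunc_binomial j (e t) (d t) M)"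
    by (intro taylor_mult assms Suc)
  ultimately show ?case by (simp add: taylor_add)
qed

lemma finsum_two_families:
  assumes "\<And>i. i \<le> k \<Longrightarrow> u (False, i) \<in> carrier P" "\<And>i. i \<le> k \<Longrightarrow> u (True, i) \<in> carrier P"
  shows "(\<Oplus>\<^bsub>P\<^esub>j\<in>UNIV \<times> {..k::nat}. u j) = (\<Oplus>\<^bsub>P\<^esub>i\<in>{..k}. u (False, i)) \<oplus>\<^bsub>P\<^esub> (\<Oplus>\<^bsub>P\<^esub>i\<in>{..k}. u (True, i))"
proof -
  have J: "UNIV \<times> {..k} = Pair False ` {..k} \<union> Pair True ` {..k}"
    by (auto simp: image_iff)
  have "(\<Oplus>\<^bsub>P\<^esub>j\<in>UNIV \<times> {..k}. u j) = (\<Oplus>\<^bsub>P\<^esub>j\<in>Pair False ` {..k}. u j) \<oplus>\<^bsub>P\<^esub> (\<Oplus>\<^bsub>P\<^esub>j\<in>Pair True ` {..k}. u j)"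
    unfolding J using assms by (intro P.finsum_Un_disjoint) auto
  then show ?thesis
    using assms by (subst (asm) (1 2) P.finsum_reindex) (auto simp: inj_on_def)
qed

text \<open>Stepanov's method. The leading term of the right hand side is $q k$, which after division by
$M = 2k + 1$ is slightly less than $\frac{q}{2}$. After this division the remaining terms are small compared
with $q$ if $M$ is large and $q$ is large in terms of $M$. The simple root of $f$ rules out constant multiples of squares, on which the character may be constant.\<close>

lemma stepanov_bound:
  assumes f: "f \<in> polys r" "ev \<zero> f = \<one>"
    and root: "f = lin t0 \<otimes>\<^bsub>P\<^esub> f1" "f1 \<in> carrier P" "t0 \<in> carrier R" "ev t0 f1 \<noteq> \<zero>"
    and M: "M = 2 * k + 1" and D: "D = M * (r * M + k)"
    and small: "r + 2 * D < q" "M \<le> q"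
    and S: "S = {t \<in> carrier R. ev t f \<noteq> \<zero> \<and> ev t f [^] half = \<epsilon>}" and eps: "\<epsilon> \<in> carrier R"
  shows "M * card S \<le> D + r * half + q * k"
proof -
  define J where "J = (UNIV :: bool set) \<times> {..k}"
  define e where "e t = const (ev t f)" for t
  define d where "d t = f \<ominus>\<^bsub>P\<^esub> e t" for t
  define w where "w t = P.trunc_binomial half (e t) (d t) M" for t
  \<comment> \<open>To order $M$ at a point $t$ with $g(t) = \epsilon$, the product $e^M g$ is $\epsilon w$. The pairs \<open>(False, i)\<close> and \<open>(True, i)\<close>
      index the families that multiply $a_i$ and $b_i$.\<close>
  define G where "G j t = (case j of (b, i) \<Rightarrow>
     (if b then const \<epsilon> \<otimes>\<^bsub>P\<^esub> w t else e t [^]\<^bsub>P\<^esub> M) \<otimes>\<^bsub>P\<^esub> const t [^]\<^bsub>P\<^esub> i)" for j :: "bool \<times> nat" and t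
  have fc: "f \<in> carrier P" using f polys_carrier by blast
  have ec: "e t \<in> carrier P" and dc: "d t \<in> carrier P" and wc: "w t \<in> carrier P" if "t \<in> carrier R" for t
    using fc that unfolding e_def d_def w_def by auto
  have te: "taylor M r e" unfolding e_def[abs_def] by (rule taylor_ev[OF f(1)])
  have td: "taylor M r d" unfolding d_def[abs_def] a_minus_def
    by (intro taylor_add taylor_poly f taylor_uminus te)
  have tw: "taylor M (r * M) w" unfolding w_def[abs_def] by (rule taylor_trunc_binomial[OF te td])
  have tG: "taylor M (r * M + k) (G j)" if jJ: "j \<in> J" for j
  proof -
    obtain b i where j: "j = (b, i)" "i \<le> k" using jJ unfolding J_def by (cases j) auto
    have "taylor M (0 + r * M) (\<lambda>t. const \<epsilon> \<otimes>\<^bsub>P\<^esub> w t)"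
      by (intro taylor_mult_poly polys_const eps tw)
    then have "taylor M (r * M) (\<lambda>t. if b then const \<epsilon> \<otimes>\<^bsub>P\<^esub> w t else e t [^]\<^bsub>P\<^esub> M)"
      using taylor_pow[OF te, of M] by (cases b) auto
    from taylor_mult[OF this taylor_pow[OF taylor_var, of M i]]
    show ?thesis unfolding G_def j prod.case by (rule taylor_mono) (use j in simp)
  qed
  \<comment> \<open>$2 (k + 1) = M + 1$ unknowns against $M$ equations.\<close>
  have cardJ: "finite J" "card J = Suc M" by (simp_all add: J_def card_cartesian_product M)
  obtain c where c: "\<forall>j\<in>J. c j \<in> polys D" "\<exists>j\<in>J. c j \<noteq> \<zero>\<^bsub>P\<^esub>"
     "\<forall>t\<in>carrier R. lin t [^]\<^bsub>P\<^esub> M divides\<^bsub>P\<^esub> (\<Oplus>\<^bsub>P\<^esub>j\<in>J. c j \<otimes>\<^bsub>P\<^esub> G j t)"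
    using vanishing_combination[of J M "r * M + k" G, OF finite_carrier cardJ tG] unfolding D by blast
  define a b where "a i = c (False, i)" and "b i = c (True, i)" for i
  have ab: "a i \<in> polys D" "b i \<in> polys D" if "i \<le> k" for i
    using c(1) that by (auto simp: J_def a_def b_def)
  have abc: "a i \<in> carrier P" "b i \<in> carrier P" if "i \<le> k" for i
    using ab that polys_carrier by blast+
  define Y g where "Y = indet [^]\<^bsub>P\<^esub> q" and "g = f [^]\<^bsub>P\<^esub> half"
  have Yg: "Y \<in> carrier P" "g \<in> carrier P" using fc by (auto simp: Y_def g_def)
  define A where "A Z = (\<Oplus>\<^bsub>P\<^esub>i\<in>{..k}. a i \<otimes>\<^bsub>P\<^esub> Z [^]\<^bsub>P\<^esub> i)" for Z :: "nat \<Rightarrow> 'a"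
  define B where "B Z = (\<Oplus>\<^bsub>P\<^esub>i\<in>{..k}. b i \<otimes>\<^bsub>P\<^esub> Z [^]\<^bsub>P\<^esub> i)" for Z
  have AB: "A Z \<in> carrier P" "B Z \<in> carrier P" if "Z \<in> carrier P" for Z
    unfolding A_def B_def using abc that by (auto intro!: P.finsum_closed)
  define F where "F = A Y \<oplus>\<^bsub>P\<^esub> g \<otimes>\<^bsub>P\<^esub> B Y"
  have Fc: "F \<in> carrier P" unfolding F_def using AB Yg by simp
  have F0: "F \<noteq> \<zero>\<^bsub>P\<^esub>"
  proof
    assume "F = \<zero>\<^bsub>P\<^esub>"
    then have "a i = \<zero>\<^bsub>P\<^esub> \<and> b i = \<zero>\<^bsub>P\<^esub>" if "i \<le> k" for i
      using auxiliary_polynomial_nonzero[OF f root small(1), of k a b i] ab that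
      unfolding F_def A_def B_def Y_def g_def by blast
    then have "c j = \<zero>\<^bsub>P\<^esub>" if "j \<in> J" for j
      using that by (cases j; cases "fst j") (auto simp: J_def a_def b_def)
    then show False using c(2) by blast
  qed
  have div: "lin t [^]\<^bsub>P\<^esub> M divides\<^bsub>P\<^esub> F" if "t \<in> S" for t
  proof -
    have t: "t \<in> carrier R" "ev t f \<noteq> \<zero>" "ev t f [^] half = \<epsilon>" using that S by auto
    define L T E W where "L = lin t [^]\<^bsub>P\<^esub> M" and "T = const t" and "E = e t [^]\<^bsub>P\<^esub> M"
      and "W = const \<epsilon> \<otimes>\<^bsub>P\<^esub> w t"
    have cl: "L \<in> carrier P" "T \<in> carrier P" "E \<in> carrier P" "W \<in> carrier P"
      using t ec wc eps by (auto simp: L_def T_def E_def W_def)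
    have factor_out: "(\<Oplus>\<^bsub>P\<^esub>i\<in>{..k}. h i \<otimes>\<^bsub>P\<^esub> (Z \<otimes>\<^bsub>P\<^esub> T [^]\<^bsub>P\<^esub> i)) = Z \<otimes>\<^bsub>P\<^esub> (\<Oplus>\<^bsub>P\<^esub>i\<in>{..k}. h i \<otimes>\<^bsub>P\<^esub> T [^]\<^bsub>P\<^esub> i)"
      if Z: "Z \<in> carrier P" and h: "\<And>i. i \<le> k \<Longrightarrow> h i \<in> carrier P" for Z h
    proof -
      have "Z \<otimes>\<^bsub>P\<^esub> (\<Oplus>\<^bsub>P\<^esub>i\<in>{..k}. h i \<otimes>\<^bsub>P\<^esub> T [^]\<^bsub>P\<^esub> i) = (\<Oplus>\<^bsub>P\<^esub>i\<in>{..k}. Z \<otimes>\<^bsub>P\<^esub> (h i \<otimes>\<^bsub>P\<^esub> T [^]\<^bsub>P\<^esub> i))"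
        using Z h cl by (intro P.finsum_rdistr) auto
      also have "\<dots> = (\<Oplus>\<^bsub>P\<^esub>i\<in>{..k}. h i \<otimes>\<^bsub>P\<^esub> (Z \<otimes>\<^bsub>P\<^esub> T [^]\<^bsub>P\<^esub> i))"
        using Z h cl by (intro P.finsum_cong') (auto simp: P.m_lcomm)
      finally show ?thesis by (rule sym)
    qed
    have "(\<Oplus>\<^bsub>P\<^esub>j\<in>J. c j \<otimes>\<^bsub>P\<^esub> G j t)
      = (\<Oplus>\<^bsub>P\<^esub>i\<in>{..k}. a i \<otimes>\<^bsub>P\<^esub> (E \<otimes>\<^bsub>P\<^esub> T [^]\<^bsub>P\<^esub> i)) \<oplus>\<^bsub>P\<^esub> (\<Oplus>\<^bsub>P\<^esub>i\<in>{..k}. b i \<otimes>\<^bsub>P\<^esub> (W \<otimes>\<^bsub>P\<^esub> T [^]\<^bsub>P\<^esub> i))"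
      unfolding J_def using cl abc
      by (subst finsum_two_families) (auto simp: G_def E_def W_def T_def a_def b_def)
    also have "(\<Oplus>\<^bsub>P\<^esub>i\<in>{..k}. a i \<otimes>\<^bsub>P\<^esub> (E \<otimes>\<^bsub>P\<^esub> T [^]\<^bsub>P\<^esub> i)) = E \<otimes>\<^bsub>P\<^esub> A T"
      unfolding A_def by (rule factor_out[OF cl(3) abc(1)])
    also have "(\<Oplus>\<^bsub>P\<^esub>i\<in>{..k}. b i \<otimes>\<^bsub>P\<^esub> (W \<otimes>\<^bsub>P\<^esub> T [^]\<^bsub>P\<^esub> i)) = W \<otimes>\<^bsub>P\<^esub> B T"
      unfolding B_def by (rule factor_out[OF cl(4) abc(2)])
    finally have L1: "L divides\<^bsub>P\<^esub> (E \<otimes>\<^bsub>P\<^esub> A T \<oplus>\<^bsub>P\<^esub> W \<otimes>\<^bsub>P\<^esub> B T)"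
      using bspec[OF c(3) t(1)] unfolding L_def by (simp only:)
    \<comment> \<open>Modulo $(X - t)^M$ one may replace $X^q$ by $t$ and $e^M g$ by $\epsilon w$, which turns $e^M F$ into the
        combination that vanishes by construction.\<close>
    have LY: "L divides\<^bsub>P\<^esub> (Y \<ominus>\<^bsub>P\<^esub> T)"
      unfolding L_def Y_def T_def using t small(2) M by (intro lin_power_divides_frobenius) auto
    have L_sum: "L divides\<^bsub>P\<^esub> ((\<Oplus>\<^bsub>P\<^esub>i\<in>{..k}. h i \<otimes>\<^bsub>P\<^esub> Y [^]\<^bsub>P\<^esub> i) \<ominus>\<^bsub>P\<^esub> (\<Oplus>\<^bsub>P\<^esub>i\<in>{..k}. h i \<otimes>\<^bsub>P\<^esub> T [^]\<^bsub>P\<^esub> i))"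
      if h: "\<And>i. i \<le> k \<Longrightarrow> h i \<in> carrier P" for h
    proof (subst P.finsum_diff)
      show "L divides\<^bsub>P\<^esub> (\<Oplus>\<^bsub>P\<^esub>i\<in>{..k}. h i \<otimes>\<^bsub>P\<^esub> Y [^]\<^bsub>P\<^esub> i \<ominus>\<^bsub>P\<^esub> h i \<otimes>\<^bsub>P\<^esub> T [^]\<^bsub>P\<^esub> i)"
      proof (rule P.divides_finsum)
        fix i assume "i \<in> {..k}"
        then show "L divides\<^bsub>P\<^esub> (h i \<otimes>\<^bsub>P\<^esub> Y [^]\<^bsub>P\<^esub> i \<ominus>\<^bsub>P\<^esub> h i \<otimes>\<^bsub>P\<^esub> T [^]\<^bsub>P\<^esub> i)"
          using P.divides_pow_diff[OF LY] cl Yg h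
          by (intro P.divides_mult_diff) (auto simp: a_minus_def P.r_neg P.divides_zero)
      qed (use cl Yg h in auto)
    qed (use cl Yg h in auto)
    have LA: "L divides\<^bsub>P\<^esub> (A Y \<ominus>\<^bsub>P\<^esub> A T)" and LB: "L divides\<^bsub>P\<^esub> (B Y \<ominus>\<^bsub>P\<^esub> B T)"
      unfolding A_def B_def using L_sum abc by auto
    have Lg: "L divides\<^bsub>P\<^esub> (E \<otimes>\<^bsub>P\<^esub> g \<ominus>\<^bsub>P\<^esub> W)"
    proof -
      have fed: "e t \<oplus>\<^bsub>P\<^esub> d t = f"
        unfolding d_def using fc ec[OF t(1)] by (simp add: a_minus_def P.a_comm[of f] P.r_neg2)
      have en: "e t [^]\<^bsub>P\<^esub> half = const \<epsilon>"
        unfolding e_def using t fc by (simp add: const_pow[symmetric])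
      obtain s where s: "s \<in> carrier P" "g \<otimes>\<^bsub>P\<^esub> E = W \<oplus>\<^bsub>P\<^esub> d t [^]\<^bsub>P\<^esub> M \<otimes>\<^bsub>P\<^esub> s"
        using P.trunc_binomial_cong[OF ec[OF t(1)] dc[OF t(1)], of half "2 * k"]
        unfolding fed en g_def E_def W_def w_def M by auto
      have "E \<otimes>\<^bsub>P\<^esub> g \<ominus>\<^bsub>P\<^esub> W = d t [^]\<^bsub>P\<^esub> M \<otimes>\<^bsub>P\<^esub> s"
        using s cl Yg dc[OF t(1)]
        by (simp add: P.m_comm[of E] a_minus_def P.a_comm[of W] P.a_assoc P.r_neg)
      moreover have "L divides\<^bsub>P\<^esub> d t [^]\<^bsub>P\<^esub> M"
        unfolding L_def d_def e_def using t fc by (intro P.pow_divides_pow lin_divides_diff_ev) auto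
      ultimately show ?thesis
        using P.divides_mult_left[of L "d t [^]\<^bsub>P\<^esub> M" s] cl s dc[OF t(1)] by (simp add: P.m_comm)
    qed
    have "L divides\<^bsub>P\<^esub> (E \<otimes>\<^bsub>P\<^esub> (A Y \<ominus>\<^bsub>P\<^esub> A T) \<oplus>\<^bsub>P\<^esub> ((E \<otimes>\<^bsub>P\<^esub> g) \<otimes>\<^bsub>P\<^esub> B Y \<ominus>\<^bsub>P\<^esub> W \<otimes>\<^bsub>P\<^esub> B T) \<oplus>\<^bsub>P\<^esub>
        (E \<otimes>\<^bsub>P\<^esub> A T \<oplus>\<^bsub>P\<^esub> W \<otimes>\<^bsub>P\<^esub> B T))"
      using cl AB Yg by (intro P.divides_add P.divides_mult_left P.divides_mult_diff LA LB Lg L1) auto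
    moreover have "E \<otimes>\<^bsub>P\<^esub> (x \<ominus>\<^bsub>P\<^esub> x') \<oplus>\<^bsub>P\<^esub> ((E \<otimes>\<^bsub>P\<^esub> g) \<otimes>\<^bsub>P\<^esub> y \<ominus>\<^bsub>P\<^esub> W \<otimes>\<^bsub>P\<^esub> y') \<oplus>\<^bsub>P\<^esub>
        (E \<otimes>\<^bsub>P\<^esub> x' \<oplus>\<^bsub>P\<^esub> W \<otimes>\<^bsub>P\<^esub> y') = E \<otimes>\<^bsub>P\<^esub> (x \<oplus>\<^bsub>P\<^esub> g \<otimes>\<^bsub>P\<^esub> y)"
      if x: "x \<in> carrier P" "x' \<in> carrier P" "y \<in> carrier P" "y' \<in> carrier P" for x x' y y'
      using x cl(3,4) Yg(2) by algebra
    ultimately have "L divides\<^bsub>P\<^esub> (E \<otimes>\<^bsub>P\<^esub> F)"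
      using AB cl Yg unfolding F_def by metis
    moreover have "ev t E \<noteq> \<zero>"
      unfolding E_def e_def using t fc by (simp add: ev_pow ev_simps R_pow_nonzero)
    ultimately show ?thesis
      using lin_power_cancel[of t M E F] cl Fc t unfolding L_def by blast
  qed
  have low: "M * card S \<le> UnivPoly.deg R F"
    using S finite_carrier by (intro card_multiple_roots_le_deg Fc F0 div) auto
  have "F \<in> polys (D + r * half + q * k)"
  proof -
    have Yp: "Y \<in> polys q" unfolding Y_def using fc by (simp add: polys_def deg_indet_pow del: One_nat_def)
    have sum: "(\<Oplus>\<^bsub>P\<^esub>i\<in>{..k}. h i \<otimes>\<^bsub>P\<^esub> Y [^]\<^bsub>P\<^esub> i) \<in> polys (D + q * k)"
      if "\<And>i. i \<le> k \<Longrightarrow> h i \<in> polys D" for h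
      using that by (intro polys_finsum) (auto intro!: polys_mult polys_mono[OF polys_pow[OF Yp]])
    have "g \<otimes>\<^bsub>P\<^esub> B Y \<in> polys (r * half + (D + q * k))"
      unfolding g_def B_def by (intro polys_mult polys_pow f sum ab)
    moreover have "A Y \<in> polys (D + q * k)" unfolding A_def by (intro sum ab)
    ultimately show ?thesis unfolding F_def by (intro polys_add) (auto intro: polys_mono simp: ac_simps)
  qed
  then show ?thesis using low by (simp add: polys_def)
qed

section \<open>Sums of the quadratic character\<close>

text \<open>The quadratic character, defined by Euler's criterion.\<close>

definition chi :: "'a \<Rightarrow> real" where
  "chi x = (if x = \<zero> then 0 else if x [^] half = \<one> then 1 else - 1)"

lemma one_neq_minus_one: "\<one> \<noteq> \<ominus> \<one>"
proof
  assume "\<one> = \<ominus> \<one>"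
  then have "\<one> \<oplus> \<one> = \<zero>" using R.r_neg by force
  then have "\<guillemotleft>2 * m\<guillemotright>\<^sub>\<nat> = \<zero>" for m
    by (induction m) (auto simp: R.a_assoc[symmetric])
  then have "\<guillemotleft>q\<guillemotright>\<^sub>\<nat> = \<one>" unfolding q_eq by simp
  then show False using of_nat_q by simp
qed

lemma pow_half_cases:
  assumes "x \<in> carrier R" "x \<noteq> \<zero>"
  shows "x [^] half = \<one> \<or> x [^] half = \<ominus> \<one>"
proof -
  define y where "y = x [^] half"
  have y: "y \<in> carrier R" using assms by (simp add: y_def)
  have "x \<otimes> (y \<otimes> y) = x [^] q"
    using assms by (simp add: y_def q_eq mult_2 R.nat_pow_mult R.m_comm)
  also have "\<dots> = x \<otimes> \<one>" using assms by (simp add: pow_q)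
  finally have "y \<otimes> y = \<one>" using assms y R.m_lcancel[of x "y \<otimes> y" \<one>] by simp
  then have "(y \<ominus> \<one>) \<otimes> (y \<oplus> \<one>) = \<zero>"
    using y by (simp add: R.l_distr R.r_distr a_minus_def R.l_minus R.a_ac R.r_neg R.r_neg2 R.r_neg1)
  then have "y \<ominus> \<one> = \<zero> \<or> y \<oplus> \<one> = \<zero>" using y by (simp add: R.integral_iff)
  then show ?thesis using y R.minus_equality[of y \<one>] unfolding y_def by auto
qed

lemma chi_mult:
  assumes "x \<in> carrier R" "y \<in> carrier R"
  shows "chi (x \<otimes> y) = chi x * chi y"
proof (cases "x = \<zero> \<or> y = \<zero>")
  case True
  then show ?thesis using assms by (auto simp: chi_def)
next
  case False
  then show ?thesis
    using assms pow_half_cases[of x] pow_half_cases[of y] one_neq_minus_one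
    by (auto simp: chi_def R.nat_pow_distrib R.integral_iff R.l_minus)
qed

lemma chi_one: "chi \<one> = 1"
  by (simp add: chi_def)

lemma chi_finprod:
  assumes "finite J" "\<And>j. j \<in> J \<Longrightarrow> u j \<in> carrier R"
  shows "chi (\<Otimes>j\<in>J. u j) = (\<Prod>j\<in>J. chi (u j))"
  using assms by (induction J) (auto simp: chi_one chi_mult Pi_def)

lemma abs_chi_le: "\<bar>chi x\<bar> \<le> 1"
  by (simp add: chi_def)

text \<open>If $a^{(q-1)/2} = 1$ for a generator $a$, then all $q - 1$ nonzero
elements would be roots of $X^{(q-1)/2} - 1$.\<close>

lemma exists_generator:
  obtains a where "a \<in> carrier R" "a \<noteq> \<zero>" "a [^] half \<noteq> \<one>"
    "\<And>x. x \<in> carrier R \<Longrightarrow> x \<noteq> \<zero> \<Longrightarrow> \<exists>i::nat. x = a [^] i"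
proof -
  obtain a where a: "a \<in> carrier R" "a \<noteq> \<zero>" "carrier R - {\<zero>} = {a [^] i | i::nat. i \<in> UNIV}"
    using finite_field_mult_group_has_gen[OF finite_carrier] by auto
  have "a [^] half \<noteq> \<one>"
  proof
    assume an: "a [^] half = \<one>"
    have "x [^] half = \<one>" if x: "x \<in> carrier R - {\<zero>}" for x
    proof -
      obtain i :: nat where "x = a [^] i" using x unfolding a(3) by blast
      then have "x [^] half = (a [^] half) [^] i" using a by (simp add: R.nat_pow_pow mult.commute)
      then show ?thesis by (simp add: an)
    qed
    then have "carrier R - {\<zero>} \<subseteq> {x \<in> carrier R. x [^] half = \<one>}" by auto
    then have "card (carrier R - {\<zero>}) \<le> card {x \<in> carrier R. x [^] half = \<one>}"
      using finite_carrier by (intro card_mono) auto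
    also have "\<dots> \<le> half" using R.num_roots_le_deg[OF finite_carrier] half_pos by simp
    also have "card (carrier R - {\<zero>}) = 2 * half"
      using q_eq finite_carrier by (simp add: order_def card_Diff_singleton)
    finally show False using half_pos by simp
  qed
  moreover have "\<exists>i::nat. x = a [^] i" if "x \<in> carrier R" "x \<noteq> \<zero>" for x
    using a(3) that by blast
  ultimately show ?thesis using that a by blast
qed

text \<open>Euler's criterion: odd powers of a generator have character $-1$, and even powers are squares.\<close>

lemma square_in_iff_chi:
  assumes x: "x \<in> carrier R"
  shows "square_in R x \<longleftrightarrow> chi x \<noteq> -1"
proof (cases "x = \<zero>")
  case True
  then show ?thesis by (auto simp: square_in_def chi_def R.nat_pow_zero intro!: bexI[of _ \<zero>])
next
  case False
  have "chi x \<noteq> -1" if "square_in R x"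
  proof -
    obtain y where y: "y \<in> carrier R" "x = y \<otimes> y"
      using \<open>square_in R x\<close> by (auto simp: square_in_def numeral_2_eq_2)
    then have "chi x = chi y * chi y" by (simp add: chi_mult)
    then show ?thesis by (simp add: chi_def split: if_splits)
  qed
  moreover have "square_in R x" if "chi x \<noteq> -1"
  proof -
    have xn: "x [^] half = \<one>" using that False by (auto simp: chi_def split: if_splits)
    obtain a where a: "a \<in> carrier R" "a \<noteq> \<zero>" "a [^] half \<noteq> \<one>"
      "\<And>x. x \<in> carrier R \<Longrightarrow> x \<noteq> \<zero> \<Longrightarrow> \<exists>i::nat. x = a [^] i"
      using exists_generator by metis
    obtain i :: nat where i: "x = a [^] i" using a(4)[OF x False] by blast
    have "a [^] half = \<ominus> \<one>" using pow_half_cases[OF a(1,2)] a(3) by blast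
    then have "a [^] half \<otimes> a [^] half = \<one>" by (simp add: R.l_minus R.r_minus)
    then have "(a [^] (2 * j)) [^] half = \<one>" for j :: nat
    proof -
      assume "a [^] half \<otimes> a [^] half = \<one>"
      then have "(a [^] (half + half)) = \<one>" using a by (simp add: R.nat_pow_mult[symmetric])
      moreover have "(a [^] (2 * j)) [^] half = (a [^] (half + half)) [^] j"
        using a by (simp add: R.nat_pow_pow mult.commute mult.left_commute flip: mult_2)
      ultimately show ?thesis by simp
    qed
    note even = this
    have "even i"
    proof (rule ccontr)
      assume "odd i"
      then obtain j where "i = 2 * j + 1" by (elim oddE)
      then have "x [^] half = (a [^] (2 * j)) [^] half \<otimes> a [^] half"
        using a(1) by (simp add: i R.nat_pow_distrib)
      then show False using even[of j] xn a by simp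
    qed
    then obtain j where "i = j + j" by (elim evenE) (simp add: mult_2)
    then have "x = (a [^] j) [^] (2::nat)" using a i by (simp add: numeral_2_eq_2 R.nat_pow_mult)
    then show ?thesis using a by (auto simp: square_in_def)
  qed
  ultimately show ?thesis by blast
qed

text \<open>The bound for the number of $t$ with $\chi(f(t)) = \epsilon$ is used for both signs. Since together they
account for all but at most $r$ points, an upper bound for each is a lower bound for the other.\<close>

lemma character_sum_polynomial:
  assumes f: "f \<in> polys r" "ev \<zero> f = \<one>"
    and root: "f = lin t0 \<otimes>\<^bsub>P\<^esub> f1" "f1 \<in> carrier P" "t0 \<in> carrier R" "ev t0 f1 \<noteq> \<zero>"
    and M: "M = 2 * k + 1" and D: "D = M * (r * M + k)"
    and small: "r + 2 * D < q" "M \<le> q"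
  shows "real M * \<bar>\<Sum>t\<in>carrier R. chi (ev t f)\<bar> \<le> 2 * D + r * q + M * r"
proof -
  have fc: "f \<in> carrier P" using f polys_carrier by blast
  have fne: "f \<noteq> \<zero>\<^bsub>P\<^esub>" using f(2) by (auto simp: ev_simps)
  define S where "S \<epsilon> = {t \<in> carrier R. ev t f \<noteq> \<zero> \<and> ev t f [^] half = \<epsilon>}" for \<epsilon>
  define Z where "Z = {t \<in> carrier R. ev t f = \<zero>}"
  define S1 S2 where "S1 = S \<one>" and "S2 = S (\<ominus> \<one>)"
  have fin: "finite S1" "finite S2" "finite Z" using finite_carrier by (auto simp: S_def S1_def S2_def Z_def)
  have "1 * card Z \<le> UnivPoly.deg R f"
  proof (rule card_multiple_roots_le_deg[OF fin(3) _ fc fne])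
    fix t assume "t \<in> Z"
    then show "lin t [^]\<^bsub>P\<^esub> (1::nat) divides\<^bsub>P\<^esub> f"
      using lin_divides_diff_ev[OF fc, of t] fc by (auto simp: Z_def a_minus_def)
  qed (auto simp: Z_def)
  then have cZ: "card Z \<le> r" using f by (simp add: polys_def)
  have b1: "M * card S1 \<le> D + r * half + q * k"
    unfolding S1_def by (rule stepanov_bound[OF f root M D small S_def]) simp
  have b2: "M * card S2 \<le> D + r * half + q * k"
    unfolding S2_def by (rule stepanov_bound[OF f root M D small S_def]) simp
  have un: "carrier R = Z \<union> (S1 \<union> S2)"
  proof (intro equalityI subsetI)
    fix t assume "t \<in> carrier R"
    then show "t \<in> Z \<union> (S1 \<union> S2)"
      using pow_half_cases[of "ev t f"] fc by (auto simp: Z_def S_def S1_def S2_def)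
  qed (auto simp: Z_def S_def S1_def S2_def)
  have dis: "Z \<inter> (S1 \<union> S2) = {}" "S1 \<inter> S2 = {}"
    using one_neq_minus_one by (auto simp: Z_def S_def S1_def S2_def)
  have q: "q = card Z + card S1 + card S2"
    unfolding order_def un using fin dis by (simp add: card_Un_disjoint)
  then have q': "q = card Z + card S2 + card S1" by simp
  have "(\<Sum>t\<in>carrier R. chi (ev t f)) = (\<Sum>t\<in>Z. chi (ev t f)) + ((\<Sum>t\<in>S1. chi (ev t f)) + (\<Sum>t\<in>S2. chi (ev t f)))"
    unfolding un using fin dis by (simp add: sum.union_disjoint)
  also have "(\<Sum>t\<in>Z. chi (ev t f)) = 0" by (rule sum.neutral) (auto simp: Z_def chi_def)
  also have "(\<Sum>t\<in>S1. chi (ev t f)) = (\<Sum>t\<in>S1. 1)" by (rule sum.cong) (auto simp: S1_def S_def chi_def)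
  also have "(\<Sum>t\<in>S2. chi (ev t f)) = (\<Sum>t\<in>S2. -1)"
    using one_neq_minus_one by (intro sum.cong) (auto simp: S2_def S_def chi_def)
  finally have sum: "(\<Sum>t\<in>carrier R. chi (ev t f)) = real (card S1) - real (card S2)" by simp
  \<comment> \<open>Twice the bound for one sign, compared with $M q$ written as a sum over both signs and the zeros.\<close>
  have *: "M * card A + M * card A \<le> M * card A + M * card B + (2 * D + r * q + M * r)"
    if "q = card Z + card A + card B" "M * card A \<le> D + r * half + q * k" for A B :: "'a set"
  proof -
    have "M * card A + M * card A \<le> 2 * D + r * (2 * half) + q * (2 * k)" using that(2) by (simp add: algebra_simps)
    also have "r * (2 * half) \<le> r * q" using q_eq by simp
    also have "q * (2 * k) \<le> M * q" unfolding M by (simp add: algebra_simps)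
    also have "M * q = M * card A + M * card B + M * card Z" by (subst that(1)) (simp add: algebra_simps)
    also have "M * card Z \<le> M * r" using cZ by simp
    finally show ?thesis by (simp add: algebra_simps)
  qed
  have "real (M * card S1) \<le> real (M * card S2 + (2 * D + r * q + M * r))"
    using *[OF q b1] unfolding of_nat_le_iff by linarith
  moreover have "real (M * card S2) \<le> real (M * card S1 + (2 * D + r * q + M * r))"
    using *[OF q' b2] unfolding of_nat_le_iff by linarith
  ultimately show ?thesis unfolding sum by (simp add: abs_if algebra_simps)
qed

text \<open>The polynomial $\prod_j (c_j X + 1)$ has value $1$ at $0$, and as the $c_j$ are distinct and nonzero, it
has a simple root at $- c_j^{-1}$ for any chosen $j$.\<close>

lemma character_sum_linear_factors:
  assumes J: "finite J" "J \<noteq> {}" and c: "\<And>j. j \<in> J \<Longrightarrow> c j \<in> carrier R" "\<And>j. j \<in> J \<Longrightarrow> c j \<noteq> \<zero>"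
    and inj: "inj_on c J"
    and M: "M = 2 * k + 1" and D: "D = M * (card J * M + k)"
    and small: "card J + 2 * D < q" "M \<le> q"
  shows "real M * \<bar>\<Sum>t\<in>carrier R. \<Prod>j\<in>J. chi (c j \<otimes> t \<oplus> \<one>)\<bar> \<le> 2 * D + card J * q + M * card J"
proof -
  define h where "h j = const (c j) \<otimes>\<^bsub>P\<^esub> indet \<oplus>\<^bsub>P\<^esub> \<one>\<^bsub>P\<^esub>" for j
  have hp: "h j \<in> polys 1" if "j \<in> J" for j
    unfolding h_def using polys_mult[OF polys_const[of "c j" 0] polys_X[of 1]] c that
    by (intro polys_add polys_one) auto
  have hc: "h j \<in> carrier P" if "j \<in> J" for j using hp that polys_carrier by blast
  have evh: "ev t (h j) = c j \<otimes> t \<oplus> \<one>" if "j \<in> J" "t \<in> carrier R" for j t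
    unfolding h_def using c that by (subst ev_simps) (simp_all add: ev_simps del: One_nat_def)
  have ev_prod: "ev t (\<Otimes>\<^bsub>P\<^esub>j\<in>I. h j) = (\<Otimes>j\<in>I. c j \<otimes> t \<oplus> \<one>)"
    if "I \<subseteq> J" "t \<in> carrier R" for I t
  proof -
    have "finite I" using that J finite_subset by blast
    then show ?thesis using that
    proof (induction I)
      case (insert j I)
      then have "h \<in> I \<rightarrow> carrier P" "h j \<in> carrier P" "(\<lambda>j. c j \<otimes> t \<oplus> \<one>) \<in> I \<rightarrow> carrier R" "c j \<in> carrier R"
        using hc c by auto
      then show ?case using insert evh[of j t] by (simp add: ev_simps P.finprod_closed)
    qed (simp add: ev_simps)
  qed
  define f where "f = (\<Otimes>\<^bsub>P\<^esub>j\<in>J. h j)"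
  have fpolys: "(\<Otimes>\<^bsub>P\<^esub>j\<in>I. h j) \<in> polys (card I)" if "I \<subseteq> J" for I
  proof -
    have "finite I" using that J finite_subset by blast
    then show ?thesis using that
    proof (induction I)
      case (insert j I)
      then have "h \<in> I \<rightarrow> carrier P" "h j \<in> carrier P" using hc by auto
      then show ?case using insert polys_mult[OF hp[of j], of "\<Otimes>\<^bsub>P\<^esub>j\<in>I. h j" "card I"] by simp
    qed (simp add: polys_one)
  qed
  obtain j0 where j0: "j0 \<in> J" using J by blast
  define t0 where "t0 = \<ominus> (inv (c j0))"
  have inv0: "inv (c j0) \<in> carrier R" "c j0 \<otimes> inv (c j0) = \<one>"
    using c[OF j0] by (auto simp: field_Units)
  have "inv (c j0) \<noteq> \<zero>"
    using inv0 c[OF j0] by (metis R.r_null R.zero_not_one)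
  have t0: "t0 \<in> carrier R" "c j0 \<otimes> t0 = \<ominus> \<one>" "t0 \<noteq> \<zero>"
    using inv0 c[OF j0] \<open>inv (c j0) \<noteq> \<zero>\<close> by (auto simp: t0_def R.r_minus)
  define f1 where "f1 = const (c j0) \<otimes>\<^bsub>P\<^esub> (\<Otimes>\<^bsub>P\<^esub>j\<in>J - {j0}. h j)"
  have prodc: "(\<Otimes>\<^bsub>P\<^esub>j\<in>J - {j0}. h j) \<in> carrier P" using hc by (intro P.finprod_closed) auto
  have "h j0 = lin t0 \<otimes>\<^bsub>P\<^esub> const (c j0)"
  proof -
    have "const (c j0) \<otimes>\<^bsub>P\<^esub> const t0 = \<ominus>\<^bsub>P\<^esub> \<one>\<^bsub>P\<^esub>"
      using c[OF j0] t0 by (simp add: const_mult[symmetric])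
    moreover have "C \<otimes>\<^bsub>P\<^esub> x \<oplus>\<^bsub>P\<^esub> \<one>\<^bsub>P\<^esub> = (x \<ominus>\<^bsub>P\<^esub> T) \<otimes>\<^bsub>P\<^esub> C"
      if "C \<in> carrier P" "T \<in> carrier P" "x \<in> carrier P" "C \<otimes>\<^bsub>P\<^esub> T = \<ominus>\<^bsub>P\<^esub> \<one>\<^bsub>P\<^esub>" for C T x
      using that by (simp add: a_minus_def P.l_distr P.l_minus P.m_comm[of x] P.m_comm[of T])
    ultimately show ?thesis unfolding h_def lin_def using c[OF j0] t0
      by (simp del: One_nat_def monom_mult)
  qed
  moreover have "f = h j0 \<otimes>\<^bsub>P\<^esub> (\<Otimes>\<^bsub>P\<^esub>j\<in>J - {j0}. h j)"
    unfolding f_def using J j0 hc by (subst (1) insert_Diff[OF j0, symmetric], subst P.finprod_insert) auto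
  ultimately have root: "f = lin t0 \<otimes>\<^bsub>P\<^esub> f1"
    unfolding f1_def using prodc c[OF j0] t0 by (simp add: P.m_assoc)
  have f1c: "f1 \<in> carrier P" unfolding f1_def using prodc c[OF j0] by simp
  have fac: "c j \<otimes> t0 \<oplus> \<one> \<noteq> \<zero>" if "j \<in> J - {j0}" for j
  proof
    assume "c j \<otimes> t0 \<oplus> \<one> = \<zero>"
    then have "c j \<otimes> t0 = c j0 \<otimes> t0"
      using t0 c that R.minus_equality[of "c j \<otimes> t0" \<one>] by simp
    then have "c j = c j0" using R.m_rcancel[of t0 "c j" "c j0"] t0(1,3) c(1) that j0 by blast
    then show False using inj that j0 by (auto dest: inj_onD)
  qed
  have chi_prod: "chi (\<Otimes>j\<in>I. c j \<otimes> t \<oplus> \<one>) = (\<Prod>j\<in>I. chi (c j \<otimes> t \<oplus> \<one>))"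
    if "I \<subseteq> J" "t \<in> carrier R" for I t
    using that c(1) finite_subset[OF that(1) J(1)] by (intro chi_finprod) auto
  have "chi (ev t0 f1) = chi (c j0) * (\<Prod>j\<in>J - {j0}. chi (c j \<otimes> t0 \<oplus> \<one>))"
    unfolding f1_def using c t0 j0 J prodc
    by (simp add: ev_simps ev_prod[of "J - {j0}"] chi_mult R.finprod_closed Pi_def chi_prod)
  also have "\<dots> \<noteq> 0" using fac J c[OF j0] by (simp add: chi_def)
  finally have f1r: "ev t0 f1 \<noteq> \<zero>" by (auto simp: chi_def)
  have f0: "ev \<zero> f = \<one>" unfolding f_def using c
    by (subst ev_prod) (auto intro!: R.finprod_one_eqI)
  have sum: "(\<Sum>t\<in>carrier R. \<Prod>j\<in>J. chi (c j \<otimes> t \<oplus> \<one>)) = (\<Sum>t\<in>carrier R. chi (ev t f))"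
    unfolding f_def using c J by (intro sum.cong refl) (simp add: ev_prod chi_prod)
  show ?thesis
    unfolding sum
    by (rule character_sum_polynomial[OF fpolys[OF order_refl, folded f_def] f0 root f1c t0(1) f1r M D small])
qed

end

section \<open>Counting tuples\<close>

lemma sum_PiE_insert:
  assumes "i \<notin> I"
  shows "(\<Sum>x\<in>insert i I \<rightarrow>\<^sub>E V. F x) = (\<Sum>y\<in>I \<rightarrow>\<^sub>E V. \<Sum>t\<in>V. F (y(i := t)))"
proof -
  have "(\<Sum>x\<in>insert i I \<rightarrow>\<^sub>E V. F x) = (\<Sum>(t, y)\<in>V \<times> (I \<rightarrow>\<^sub>E V). F (y(i := t)))"
    unfolding PiE_insert_eq by (subst sum.reindex[OF inj_combinator[OF assms]]) (simp add: case_prod_unfold)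
  also have "\<dots> = (\<Sum>t\<in>V. \<Sum>y\<in>I \<rightarrow>\<^sub>E V. F (y(i := t)))"
    by (rule sum.cartesian_product[symmetric])
  finally show ?thesis by (subst (asm) sum.swap)
qed

text \<open>Forgetting a coordinate that is a function of the others is injective.\<close>

lemma card_determined_coordinate:
  assumes "finite I" "finite V" "j \<in> I" "Z \<subseteq> I \<rightarrow>\<^sub>E V"
    and det: "\<And>x y. x \<in> Z \<Longrightarrow> y \<in> Z \<Longrightarrow> (\<And>i. i \<in> I - {j} \<Longrightarrow> x i = y i) \<Longrightarrow> x j = y j"
  shows "card Z \<le> card V ^ (card I - 1)" "card Z * card V \<le> card V ^ card I"
proof -
  have "inj_on (\<lambda>x. restrict x (I - {j})) Z"
  proof (rule inj_onI)
    fix x y assume xy: "x \<in> Z" "y \<in> Z" and eq: "restrict x (I - {j}) = restrict y (I - {j})"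
    have *: "x i = y i" if "i \<in> I - {j}" for i using fun_cong[OF eq, of i] that by simp
    show "x = y"
    proof (rule PiE_ext[of x I "\<lambda>_. V" y])
      fix i assume "i \<in> I"
      then show "x i = y i" using * det[OF xy *] by (cases "i = j") auto
    qed (use xy assms(4) in blast)+
  qed
  moreover have "(\<lambda>x. restrict x (I - {j})) ` Z \<subseteq> (I - {j}) \<rightarrow>\<^sub>E V"
    using assms(4) by (auto simp: PiE_def Pi_def)
  ultimately have "card Z \<le> card ((I - {j}) \<rightarrow>\<^sub>E V)"
    using assms(1,2) by (intro card_inj_on_le finite_PiE) auto
  also have "\<dots> = card V ^ (card I - 1)"
    using assms(1,3) by (simp add: card_funcsetE)
  finally show *: "card Z \<le> card V ^ (card I - 1)" .
  have "0 < card I" using assms(1,3) card_gt_0_iff by blast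
  have "card Z * card V \<le> card V ^ (card I - 1) * card V"
    using * by (rule mult_right_mono) simp
  also have "\<dots> = card V ^ card I" using \<open>0 < card I\<close> by (rule power_minus_mult)
  finally show "card Z * card V \<le> card V ^ card I" .
qed

lemma abs_prod_le_1:
  fixes u :: "'b \<Rightarrow> real"
  assumes "\<And>j. j \<in> J \<Longrightarrow> \<bar>u j\<bar> \<le> 1"
  shows "\<bar>\<Prod>j\<in>J. u j\<bar> \<le> 1"
  unfolding abs_prod using assms by (intro prod_le_1) auto

context odd_finite_field
begin

definition monomial :: "('i \<Rightarrow> 'a) \<Rightarrow> 'i set \<Rightarrow> 'a" where
  "monomial x S = (\<Otimes>i\<in>S. x i)"

lemma monomial_closed:
  "x \<in> I \<rightarrow>\<^sub>E carrier R \<Longrightarrow> S \<subseteq> I \<Longrightarrow> monomial x S \<in> carrier R"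
  unfolding monomial_def by (intro R.finprod_closed) auto

lemma monomial_cong:
  "y \<in> I \<rightarrow>\<^sub>E carrier R \<Longrightarrow> S \<subseteq> I \<Longrightarrow> (\<And>i. i \<in> S \<Longrightarrow> x i = y i) \<Longrightarrow> monomial x S = monomial y S"
  unfolding monomial_def by (intro R.finprod_cong') auto

lemma monomial_split:
  assumes "finite I" "x \<in> I \<rightarrow>\<^sub>E carrier R" "S \<subseteq> I" "i \<in> S"
  shows "monomial x S = monomial x (S - {i}) \<otimes> x i"
proof -
  have "x \<in> (S - {i}) \<rightarrow> carrier R" "x i \<in> carrier R" "finite (S - {i})"
    using assms finite_subset[of S I] by auto
  then have "monomial x (insert i (S - {i})) = x i \<otimes> monomial x (S - {i})"
    unfolding monomial_def by (intro R.finprod_insert) auto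
  moreover have "monomial x (S - {i}) \<in> carrier R"
    using assms by (intro monomial_closed[OF assms(2)]) auto
  ultimately show ?thesis using assms(4) \<open>x i \<in> carrier R\<close> by (simp add: insert_absorb R.m_comm)
qed

lemma monomial_nonzero:
  assumes "finite S" "\<And>i. i \<in> S \<Longrightarrow> x i \<in> carrier R \<and> x i \<noteq> \<zero>"
  shows "monomial x S \<noteq> \<zero>"
proof -
  have "monomial x S \<in> carrier R \<and> monomial x S \<noteq> \<zero>"
    using assms unfolding monomial_def
    by (induction S) (auto simp: R.integral_iff Pi_def)
  then show ?thesis by blast
qed

lemma finite_tuples: "finite I \<Longrightarrow> finite (I \<rightarrow>\<^sub>E carrier R)"
  using finite_carrier by (intro finite_PiE) auto

text \<open>For a coordinate $i$ that occurs in some $S \in \mathcal{F}$, the inner sum over $t = x_i$ is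
$\sum_t \prod_{S \ni i} \chi(c_S t + 1)$, up to a factor of absolute value at most $1$. It is
bounded by $B$ when the $c_S$ are nonzero and distinct, and by $q$ always. The exceptional choices of
the other coordinates have a zero coordinate $x_j = 0$, or have nonzero coordinates and a coincidence
$c_S = c_{S'}$. In the second case a coordinate $j \in S \setminus S'$ is determined by the others. So
each of the at most $|I| + |\mathcal{F}|^2$ kinds of exceptions is rarer than the generic choice by a
factor of $q$.\<close>

lemma pattern_sum_bound:
  fixes I :: "'i set"
  assumes I: "finite I" and B0: "0 \<le> B" and sets: "\<And>S. S \<in> \<F> \<Longrightarrow> S \<subseteq> I \<and> card S = k" and k: "0 < k" and ne: "\<F> \<noteq> {}"
    and B: "\<And>J c. J \<subseteq> \<F> \<Longrightarrow> J \<noteq> {} \<Longrightarrow> inj_on c J \<Longrightarrow> (\<And>S. S \<in> J \<Longrightarrow> c S \<in> carrier R \<and> c S \<noteq> \<zero>) \<Longrightarrow>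
       \<bar>\<Sum>t\<in>carrier R. \<Prod>S\<in>J. chi (c S \<otimes> t \<oplus> \<one>)\<bar> \<le> B"
  shows "\<bar>\<Sum>x\<in>I \<rightarrow>\<^sub>E carrier R. \<Prod>S\<in>\<F>. chi (monomial x S \<oplus> \<one>)\<bar>
     \<le> real q ^ (card I - 1) * (B + card I + (card \<F>)\<^sup>2)"
proof -
  obtain S0 i where S0: "S0 \<in> \<F>" "i \<in> S0" using ne sets k by fastforce
  have iI: "i \<in> I" using S0 sets by blast
  define I' where "I' = I - {i}"
  have I': "finite I'" "i \<notin> I'" "I = insert i I'" "card I' = card I - 1" using I iI by (auto simp: I'_def)
  define V where "V = carrier R"
  define T where "T = I' \<rightarrow>\<^sub>E V"
  have finT: "finite T" and finV: "finite V" unfolding T_def V_def using I' finite_tuples finite_carrier by auto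
  have q: "card V = q" by (simp add: V_def order_def)
  have cardT: "card T = q ^ card I'" using I' by (simp add: T_def card_funcsetE q)
  have finF: "finite \<F>" using sets I by (intro finite_subset[of \<F> "Pow I"]) auto
  define J where "J = {S \<in> \<F>. i \<in> S}"
  have J: "J \<subseteq> \<F>" "J \<noteq> {}" using S0 by (auto simp: J_def)
  define c where "c y S = monomial y (S - {i})" for y :: "'i \<Rightarrow> 'a" and S
  have sub: "S - {i} \<subseteq> I'" if "S \<in> \<F>" for S using sets that by (auto simp: I'_def)
  have subJ: "S \<subseteq> I'" if "S \<in> \<F> - J" for S using sets that by (auto simp: I'_def J_def)
  have c_closed: "c y S \<in> carrier R" if "y \<in> T" "S \<in> \<F>" for y S
    unfolding c_def using that sub by (intro monomial_closed[of y I']) (auto simp: T_def V_def)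
  \<comment> \<open>The factors that do not involve the coordinate $i$.\<close>
  define outer where "outer y = (\<Prod>S\<in>\<F> - J. chi (monomial y S \<oplus> \<one>))" for y
  have split: "(\<Prod>S\<in>\<F>. chi (monomial (y(i := t)) S \<oplus> \<one>))
     = outer y * (\<Prod>S\<in>J. chi (c y S \<otimes> t \<oplus> \<one>))" if y: "y \<in> T" and t: "t \<in> V" for y t
  proof -
    have y': "y \<in> I' \<rightarrow>\<^sub>E carrier R" using y by (simp add: T_def V_def)
    have x': "y(i := t) \<in> I \<rightarrow>\<^sub>E carrier R"
      using y' t unfolding I'(3) V_def by (intro PiE_fun_upd)
    have "monomial (y(i := t)) S = monomial y S" if "S \<in> \<F> - J" for S
      using subJ[OF that] I'(2) by (intro monomial_cong[OF y']) auto
    moreover have "monomial (y(i := t)) S = c y S \<otimes> t" if "S \<in> J" for S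
    proof -
      have "monomial (y(i := t)) (S - {i}) = c y S"
        unfolding c_def using sub[of S] that J(1) by (intro monomial_cong[OF y']) auto
      then show ?thesis
        using monomial_split[OF I x', of S i] sets[of S] that by (auto simp: J_def)
    qed
    ultimately show ?thesis
      unfolding outer_def using J(1) finF by (subst prod.subset_diff[of J \<F>]) auto
  qed
  have "(\<Sum>x\<in>I \<rightarrow>\<^sub>E V. \<Prod>S\<in>\<F>. chi (monomial x S \<oplus> \<one>))
     = (\<Sum>y\<in>T. \<Sum>t\<in>V. \<Prod>S\<in>\<F>. chi (monomial (y(i := t)) S \<oplus> \<one>))"
    unfolding T_def I'(3) by (rule sum_PiE_insert[OF I'(2)])
  also have "\<dots> = (\<Sum>y\<in>T. outer y * (\<Sum>t\<in>V. \<Prod>S\<in>J. chi (c y S \<otimes> t \<oplus> \<one>)))"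
    by (simp add: split sum_distrib_left)
  finally have eq: "(\<Sum>x\<in>I \<rightarrow>\<^sub>E V. \<Prod>S\<in>\<F>. chi (monomial x S \<oplus> \<one>))
      = (\<Sum>y\<in>T. outer y * (\<Sum>t\<in>V. \<Prod>S\<in>J. chi (c y S \<otimes> t \<oplus> \<one>)))" .
  \<comment> \<open>The exceptional choices of the coordinates other than $i$.\<close>
  define Z0 where "Z0 j = {y \<in> T. y j = \<zero>}" for j
  define Z1 where "Z1 p = {y \<in> T. (\<forall>j\<in>I'. y j \<noteq> \<zero>) \<and> c y (fst p) = c y (snd p)}" for p
  define Pairs where "Pairs = {p \<in> J \<times> J. fst p \<noteq> snd p}"
  define Bad where "Bad = (\<Union>j\<in>I'. Z0 j) \<union> (\<Union>p\<in>Pairs. Z1 p)"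
  have Z0: "card (Z0 j) * q \<le> q ^ card I'" if "j \<in> I'" for j
    using card_determined_coordinate(2)[OF I'(1) finV that, of "Z0 j"] unfolding q
    by (auto simp: Z0_def T_def)
  have Z1: "card (Z1 p) * q \<le> q ^ card I'" if p: "p \<in> Pairs" for p
  proof -
    obtain S S' where pS: "p = (S, S')" "S \<in> \<F>" "S' \<in> \<F>" "i \<in> S" "i \<in> S'" "S \<noteq> S'"
      using p by (cases p) (auto simp: Pairs_def J_def)
    have finS: "finite S" "finite S'" using pS sets I finite_subset by blast+
    have "\<not> S \<subseteq> S'" using card_subset_eq[of S' S] finS pS sets by auto
    then obtain j where j: "j \<in> S" "j \<notin> S'" by blast
    have jI: "j \<in> I'" "j \<in> S - {i}" using j pS sets by (auto simp: I'_def)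
    show ?thesis unfolding q[symmetric]
    proof (rule card_determined_coordinate(2)[OF I'(1) finV jI(1)])
      fix x y assume x: "x \<in> Z1 p" and y: "y \<in> Z1 p" and agree: "\<And>i. i \<in> I' - {j} \<Longrightarrow> x i = y i"
      have xT: "x \<in> I' \<rightarrow>\<^sub>E carrier R" "y \<in> I' \<rightarrow>\<^sub>E carrier R" using x y by (auto simp: Z1_def T_def V_def)
      have "c x S' = c y S'"
        unfolding c_def using sub[OF pS(3)] j agree by (intro monomial_cong[OF xT(2)]) auto
      then have "c x S = c y S" using x y pS(1) by (auto simp: Z1_def)
      define d where "d = monomial y (S - {i} - {j})"
      have dx: "monomial x (S - {i} - {j}) = d"
        unfolding d_def using sub[OF pS(2)] agree by (intro monomial_cong[OF xT(2)]) auto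
      have d: "d \<in> carrier R" "d \<noteq> \<zero>"
        unfolding d_def using sub[OF pS(2)] finS xT y
        by (intro monomial_closed[OF xT(2)] monomial_nonzero; auto simp: Z1_def)+
      have "d \<otimes> x j = d \<otimes> y j"
        using \<open>c x S = c y S\<close> monomial_split[OF I'(1) xT(1) sub[OF pS(2)] jI(2)]
          monomial_split[OF I'(1) xT(2) sub[OF pS(2)] jI(2)]
        unfolding c_def dx d_def[symmetric] by simp
      then show "x j = y j" using d xT jI R.m_lcancel[of d "x j" "y j"] by auto
    qed (auto simp: Z1_def T_def)
  qed
  have finJ: "finite J" using J(1) finF finite_subset by blast
  have finP: "finite Pairs" and cardP: "card Pairs \<le> (card \<F>)\<^sup>2"
  proof -
    show "finite Pairs" unfolding Pairs_def using finJ by auto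
    have "card Pairs \<le> card (\<F> \<times> \<F>)" unfolding Pairs_def using J finF by (intro card_mono) auto
    then show "card Pairs \<le> (card \<F>)\<^sup>2" unfolding Power.power2_eq_square card_cartesian_product .
  qed
  have "card Bad * q \<le> (card (\<Union>j\<in>I'. Z0 j) + card (\<Union>p\<in>Pairs. Z1 p)) * q"
    unfolding Bad_def by (intro mult_right_mono card_Un_le) simp
  also have "\<dots> \<le> ((\<Sum>j\<in>I'. card (Z0 j)) + (\<Sum>p\<in>Pairs. card (Z1 p))) * q"
    using I'(1) finP by (intro mult_right_mono add_mono card_UN_le) auto
  also have "\<dots> = (\<Sum>j\<in>I'. card (Z0 j) * q) + (\<Sum>p\<in>Pairs. card (Z1 p) * q)"
    by (simp add: add_mult_distrib sum_distrib_right)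
  also have "\<dots> \<le> (\<Sum>j\<in>I'. q ^ card I') + (\<Sum>p\<in>Pairs. q ^ card I')"
    using Z0 Z1 by (intro add_mono sum_mono)
  also have "\<dots> = (card I' + card Pairs) * q ^ card I'" by (simp add: add_mult_distrib)
  also have "\<dots> \<le> (card I + (card \<F>)\<^sup>2) * q ^ card I'"
    using cardP I'(4) by (intro mult_right_mono add_mono) auto
  finally have bad: "card Bad * q \<le> (card I + (card \<F>)\<^sup>2) * q ^ card I'" .
  have BadT: "Bad \<subseteq> T" by (auto simp: Bad_def Z0_def Z1_def)
  have outer: "\<bar>outer y\<bar> \<le> 1" for y unfolding outer_def by (intro abs_prod_le_1 abs_chi_le)
  have trivial: "\<bar>\<Sum>t\<in>V. \<Prod>S\<in>J. chi (c y S \<otimes> t \<oplus> \<one>)\<bar> \<le> q" for y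
  proof -
    have "\<bar>\<Sum>t\<in>V. \<Prod>S\<in>J. chi (c y S \<otimes> t \<oplus> \<one>)\<bar> \<le> (\<Sum>t\<in>V. 1)"
      by (intro order_trans[OF sum_abs] sum_mono abs_prod_le_1 abs_chi_le)
    then show ?thesis by (simp add: q)
  qed
  have good: "\<bar>\<Sum>t\<in>V. \<Prod>S\<in>J. chi (c y S \<otimes> t \<oplus> \<one>)\<bar> \<le> B" if y: "y \<in> T - Bad" for y
    unfolding V_def
  proof (rule B[OF J])
    have nz: "y j \<noteq> \<zero>" if "j \<in> I'" for j using y that by (auto simp: Bad_def Z0_def)
    show "inj_on (c y) J"
    proof (rule inj_onI, rule ccontr)
      fix S S' assume "S \<in> J" "S' \<in> J" "c y S = c y S'" "S \<noteq> S'"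
      then have "y \<in> Bad" using y nz unfolding Bad_def Z1_def Pairs_def by auto
      then show False using y by blast
    qed
    fix S assume "S \<in> J"
    then have S: "S \<in> \<F>" using J by blast
    have "c y S \<noteq> \<zero>" unfolding c_def
    proof (rule monomial_nonzero)
      show "finite (S - {i})" using sub[OF S] I'(1) finite_subset by blast
      show "y j \<in> carrier R \<and> y j \<noteq> \<zero>" if "j \<in> S - {i}" for j
        using that sub[OF S] nz y by (auto simp: T_def V_def)
    qed
    then show "c y S \<in> carrier R \<and> c y S \<noteq> \<zero>" using c_closed y S by blast
  qed
  have "\<bar>\<Sum>y\<in>T. outer y * (\<Sum>t\<in>V. \<Prod>S\<in>J. chi (c y S \<otimes> t \<oplus> \<one>))\<bar>
      \<le> (\<Sum>y\<in>T. \<bar>\<Sum>t\<in>V. \<Prod>S\<in>J. chi (c y S \<otimes> t \<oplus> \<one>)\<bar>)"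
    using outer by (intro order_trans[OF sum_abs] sum_mono) (auto simp: abs_mult intro: mult_left_le_one_le)
  also have "\<dots> \<le> (\<Sum>y\<in>T. B + (if y \<in> Bad then real q else 0))"
    using trivial good B0 by (intro sum_mono) (auto intro: add_increasing)
  also have "\<dots> = real (card T) * B + real (card Bad * q)"
    using finT BadT by (simp add: sum.distrib sum.If_cases Int_absorb1)
  also have "\<dots> \<le> real (card T) * B + real ((card I + (card \<F>)\<^sup>2) * q ^ card I')"
    using bad by (intro add_left_mono) (simp only: of_nat_le_iff)
  also have "\<dots> = real q ^ (card I - 1) * (B + card I + (card \<F>)\<^sup>2)"
    by (simp add: cardT I'(4) algebra_simps)
  finally show ?thesis unfolding eq[unfolded V_def] V_def .
qed

definition good_tuple :: "nat \<Rightarrow> 'i set \<Rightarrow> ('i \<Rightarrow> 'a) \<Rightarrow> bool" where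
  "good_tuple k I x \<longleftrightarrow> inj_on x I \<and> (\<forall>S. S \<subseteq> I \<and> card S = k \<longrightarrow> square_in R (monomial x S \<oplus> \<one>))"

text \<open>The weight $w(x) = \prod_S (1 + \chi(x_S + 1))$ is $2^N$ on good tuples and $0$ on the others, except on
the set $E$ of tuples with a repeated entry or with some $x_S = -1$. Its total is $q^{|I|}$ plus
the contributions of the nonempty families, each of which obeys the bound for patterns.\<close>

lemma good_tuple_count:
  fixes I :: "'i set"
  assumes I: "finite I" and k: "0 < k" and B0: "0 \<le> B"
    and B: "\<And>(J :: 'i set set) c. J \<subseteq> {S. S \<subseteq> I \<and> card S = k} \<Longrightarrow> J \<noteq> {} \<Longrightarrow> inj_on c J \<Longrightarrow> (\<And>S. S \<in> J \<Longrightarrow> c S \<in> carrier R \<and> c S \<noteq> \<zero>) \<Longrightarrow>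
       \<bar>\<Sum>t\<in>carrier R. \<Prod>S\<in>J. chi (c S \<otimes> t \<oplus> \<one>)\<bar> \<le> B"
    and N: "N = card I choose k"
  shows "\<bar>2 ^ N * real (card {x \<in> I \<rightarrow>\<^sub>E carrier R. good_tuple k I x}) - real q ^ card I\<bar>
     \<le> 2 ^ N * (real q ^ (card I - 1) * (B + card I + N\<^sup>2 + (card I)\<^sup>2 + N))"
proof -
  define V where "V = carrier R"
  define T where "T = I \<rightarrow>\<^sub>E V"
  define \<C> where "\<C> = {S. S \<subseteq> I \<and> card S = k}"
  have finT: "finite T" and finV: "finite V" unfolding T_def V_def using I finite_tuples finite_carrier by auto
  have q: "card V = q" by (simp add: V_def order_def)
  have cardT: "card T = q ^ card I" using I by (simp add: T_def card_funcsetE q)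
  have finC: "finite \<C>" unfolding \<C>_def using I by simp
  have cardC: "card \<C> = N" unfolding \<C>_def N using I by (rule n_subsets)
  have inC: "S \<subseteq> I" "card S = k" "finite S" if "S \<in> \<C>" for S
    using that I finite_subset unfolding \<C>_def by auto
  have T: "x \<in> I \<rightarrow>\<^sub>E carrier R" if "x \<in> T" for x using that by (simp add: T_def V_def)
  have mc: "monomial x S \<in> carrier R" if "x \<in> T" "S \<in> \<C>" for x S
    using monomial_closed[OF T inC(1)] that by blast
  define \<phi> where "\<phi> x S = chi (monomial x S \<oplus> \<one>)" for x :: "'i \<Rightarrow> 'a" and S
  define w where "w x = (\<Prod>S\<in>\<C>. 1 + \<phi> x S)" for x
  define D where "D = {x \<in> T. good_tuple k I x}"
  define E where "E = {x \<in> T. \<not> inj_on x I} \<union> {x \<in> T. \<exists>S\<in>\<C>. monomial x S \<oplus> \<one> = \<zero>}"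
  have \<phi>1: "\<bar>\<phi> x S\<bar> \<le> 1" for x S unfolding \<phi>_def by (rule abs_chi_le)

  have "(\<Sum>x\<in>T. w x) = (\<Sum>x\<in>T. \<Sum>\<F>\<in>Pow \<C>. \<Prod>S\<in>\<F>. \<phi> x S)"
    unfolding w_def by (subst add.commute, subst prod_add[OF finC]) simp
  also have "\<dots> = (\<Sum>\<F>\<in>Pow \<C>. \<Sum>x\<in>T. \<Prod>S\<in>\<F>. \<phi> x S)"
    by (rule sum.swap)
  also have "\<dots> = real q ^ card I + (\<Sum>\<F>\<in>Pow \<C> - {{}}. \<Sum>x\<in>T. \<Prod>S\<in>\<F>. \<phi> x S)"
    using finC by (subst sum.remove[of _ "{}"]) (auto simp: cardT)
  finally have "\<bar>(\<Sum>x\<in>T. w x) - real q ^ card I\<bar> = \<bar>\<Sum>\<F>\<in>Pow \<C> - {{}}. \<Sum>x\<in>T. \<Prod>S\<in>\<F>. \<phi> x S\<bar>"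
    by simp
  also have "\<dots> \<le> (\<Sum>\<F>\<in>Pow \<C> - {{}}. real q ^ (card I - 1) * (B + card I + N\<^sup>2))"
  proof (rule order_trans[OF sum_abs], rule sum_mono)
    fix \<F> assume F: "\<F> \<in> Pow \<C> - {{}}"
    have "\<bar>\<Sum>x\<in>T. \<Prod>S\<in>\<F>. \<phi> x S\<bar> \<le> real q ^ (card I - 1) * (B + card I + (card \<F>)\<^sup>2)"
      unfolding T_def V_def \<phi>_def
    proof (rule pattern_sum_bound[OF I B0 _ k])
      fix S assume "S \<in> \<F>"
      then show "S \<subseteq> I \<and> card S = k" using F inC by blast
    next
      fix J :: "'i set set" and c
      assume "J \<subseteq> \<F>" "J \<noteq> {}" "inj_on c J" "\<And>S. S \<in> J \<Longrightarrow> c S \<in> carrier R \<and> c S \<noteq> \<zero>"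
      then show "\<bar>\<Sum>t\<in>carrier R. \<Prod>S\<in>J. chi (c S \<otimes> t \<oplus> \<one>)\<bar> \<le> B"
        using F by (intro B) (auto simp: \<C>_def)
    qed (use F in auto)
    moreover have "card \<F> \<le> N" using F finC by (auto simp: cardC[symmetric] intro: card_mono)
    then have "real (card \<F>) ^ 2 \<le> real N ^ 2" by (intro power_mono) auto
    then have "real q ^ (card I - 1) * (B + card I + (card \<F>)\<^sup>2) \<le> real q ^ (card I - 1) * (B + card I + N\<^sup>2)"
      by (intro mult_left_mono) auto
    ultimately show "\<bar>\<Sum>x\<in>T. \<Prod>S\<in>\<F>. \<phi> x S\<bar> \<le> real q ^ (card I - 1) * (B + card I + N\<^sup>2)" by linarith
  qed
  also have "\<dots> = real (card (Pow \<C> - {{}})) * (real q ^ (card I - 1) * (B + card I + N\<^sup>2))" by simp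
  also have "\<dots> \<le> 2 ^ N * (real q ^ (card I - 1) * (B + card I + N\<^sup>2))"
  proof (intro mult_right_mono)
    have "card (Pow \<C> - {{}}) \<le> card (Pow \<C>)" using finC by (intro card_mono) auto
    also have "\<dots> = 2 ^ N" using finC by (simp add: card_Pow cardC)
    finally show "real (card (Pow \<C> - {{}})) \<le> 2 ^ N" by (metis of_nat_le_iff of_nat_numeral of_nat_power)
  qed (use B0 in auto)
  finally have main: "\<bar>(\<Sum>x\<in>T. w x) - real q ^ card I\<bar> \<le> 2 ^ N * (real q ^ (card I - 1) * (B + card I + N\<^sup>2))" .

  have w0: "0 \<le> w x" "w x \<le> 2 ^ N" for x
  proof -
    have f: "0 \<le> 1 + \<phi> x S" "1 + \<phi> x S \<le> 2" for S using \<phi>1[of x S] by (auto simp: abs_le_iff)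
    show "0 \<le> w x" unfolding w_def using f by (intro prod_nonneg) auto
    have "w x \<le> (\<Prod>S\<in>\<C>. 2)" unfolding w_def using f by (intro prod_mono) auto
    then show "w x \<le> 2 ^ N" by (simp add: cardC)
  qed
  have wD: "w x = (if x \<in> D then 2 ^ N else 0)" if x: "x \<in> T - E" for x
  proof -
    have nz: "monomial x S \<oplus> \<one> \<noteq> \<zero>" if "S \<in> \<C>" for S using x that by (auto simp: E_def)
    have inj: "inj_on x I" using x by (auto simp: E_def)
    have sq: "square_in R (monomial x S \<oplus> \<one>) \<longleftrightarrow> \<phi> x S \<noteq> -1" if "S \<in> \<C>" for S
      unfolding \<phi>_def using mc[of x S] x that by (intro square_in_iff_chi) auto
    have xD: "x \<in> D \<longleftrightarrow> (\<forall>S\<in>\<C>. \<phi> x S \<noteq> -1)"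
      using sq x inj by (auto simp: D_def good_tuple_def \<C>_def)
    show ?thesis
    proof (cases "x \<in> D")
      case True
      have "1 + \<phi> x S = 2" if "S \<in> \<C>" for S
        using nz[OF that] xD True that by (auto simp: \<phi>_def chi_def split: if_splits)
      then show ?thesis using True unfolding w_def by (simp add: cardC)
    next
      case False
      then obtain S where "S \<in> \<C>" "\<phi> x S = -1" using xD by blast
      then show ?thesis using False finC unfolding w_def by (auto intro!: prod_zero bexI[of _ S])
    qed
  qed
  have "2 ^ N * real (card D) = (\<Sum>x\<in>T. if x \<in> D then 2 ^ N else 0)"
    using finT by (simp add: D_def sum.If_cases Int_def)
  then have "\<bar>(\<Sum>x\<in>T. w x) - 2 ^ N * real (card D)\<bar> = \<bar>\<Sum>x\<in>T. w x - (if x \<in> D then 2 ^ N else 0)\<bar>"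
    by (simp add: sum_subtractf)
  also have "\<dots> \<le> (\<Sum>x\<in>T. if x \<in> E then 2 ^ N else 0)"
    using wD w0 by (intro order_trans[OF sum_abs] sum_mono) auto
  also have "\<dots> = 2 ^ N * real (card E)"
    using finT by (subst sum.If_cases) (auto simp: E_def Int_absorb1 Int_def intro!: arg_cong[of _ _ card])
  finally have err: "\<bar>(\<Sum>x\<in>T. w x) - 2 ^ N * real (card D)\<bar> \<le> 2 ^ N * real (card E)" .

  \<comment> \<open>The exceptional tuples: in each kind one coordinate is determined by the others. If $x_S = -1$, then the
      cofactor of $x_j$ in $x_S$ is nonzero, so that $x_j$ is determined.\<close>
  define Y where "Y p = {x \<in> T. x (fst p) = x (snd p)}" for p :: "'i \<times> 'i"
  define U where "U S = {x \<in> T. monomial x S \<oplus> \<one> = \<zero>}" for S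
  have Y: "card (Y p) \<le> q ^ (card I - 1)" if p: "p \<in> {p \<in> I \<times> I. fst p \<noteq> snd p}" for p
    unfolding q[symmetric]
  proof (rule card_determined_coordinate(1)[OF I finV, of "fst p"])
    fix x y assume "x \<in> Y p" "y \<in> Y p" and "\<And>i. i \<in> I - {fst p} \<Longrightarrow> x i = y i"
    then show "x (fst p) = y (fst p)" using p by (auto simp: Y_def)
  qed (use p in \<open>auto simp: Y_def T_def\<close>)
  have U: "card (U S) \<le> q ^ (card I - 1)" if S: "S \<in> \<C>" for S
  proof -
    obtain j where j: "j \<in> S" using inC[OF S] k by fastforce
    show ?thesis unfolding q[symmetric]
    proof (rule card_determined_coordinate(1)[OF I finV, of j])
      fix x y assume x: "x \<in> U S" and y: "y \<in> U S" and agree: "\<And>i. i \<in> I - {j} \<Longrightarrow> x i = y i"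
      have xy: "x \<in> I \<rightarrow>\<^sub>E carrier R" "y \<in> I \<rightarrow>\<^sub>E carrier R" using x y T by (auto simp: U_def)
      have xyj: "x j \<in> carrier R" "y j \<in> carrier R" using xy j inC[OF S] by auto
      define d where "d = monomial y (S - {j})"
      have d: "d \<in> carrier R" unfolding d_def using xy inC[OF S] by (intro monomial_closed[OF xy(2)]) auto
      have "monomial x (S - {j}) = d"
        unfolding d_def using agree inC[OF S] by (intro monomial_cong[OF xy(2)]) auto
      then have eq: "d \<otimes> x j \<oplus> \<one> = \<zero>" "d \<otimes> y j \<oplus> \<one> = \<zero>"
        using x y monomial_split[OF I xy(1) inC(1)[OF S] j] monomial_split[OF I xy(2) inC(1)[OF S] j]
        by (auto simp: U_def d_def)
      then have "d \<noteq> \<zero>" using xyj by auto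
      moreover have "d \<otimes> x j = d \<otimes> y j"
        using eq d xyj R.minus_equality[of "d \<otimes> x j" \<one>] R.minus_equality[of "d \<otimes> y j" \<one>] by simp
      ultimately show "x j = y j" using d xyj R.m_lcancel[of d "x j" "y j"] by blast
    qed (use j inC[OF S] in \<open>auto simp: U_def T_def\<close>)
  qed
  have finII: "finite {p \<in> I \<times> I. fst p \<noteq> snd p}" using I by simp
  have "E \<subseteq> (\<Union>p\<in>{p \<in> I \<times> I. fst p \<noteq> snd p}. Y p) \<union> (\<Union>S\<in>\<C>. U S)"
    by (auto simp: E_def Y_def U_def inj_on_def)
  then have "card E \<le> card ((\<Union>p\<in>{p \<in> I \<times> I. fst p \<noteq> snd p}. Y p) \<union> (\<Union>S\<in>\<C>. U S))"
    using finT finII finC by (intro card_mono) (auto simp: Y_def U_def)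
  also have "\<dots> \<le> card (\<Union>p\<in>{p \<in> I \<times> I. fst p \<noteq> snd p}. Y p) + card (\<Union>S\<in>\<C>. U S)"
    by (rule card_Un_le)
  also have "\<dots> \<le> (\<Sum>p\<in>{p \<in> I \<times> I. fst p \<noteq> snd p}. card (Y p)) + (\<Sum>S\<in>\<C>. card (U S))"
    using finII finC by (intro add_mono card_UN_le)
  also have "\<dots> \<le> (\<Sum>p\<in>{p \<in> I \<times> I. fst p \<noteq> snd p}. q ^ (card I - 1)) + (\<Sum>S\<in>\<C>. q ^ (card I - 1))"
    using Y U by (intro add_mono sum_mono)
  also have "\<dots> = (card {p \<in> I \<times> I. fst p \<noteq> snd p} + N) * q ^ (card I - 1)"
    by (simp add: cardC add_mult_distrib)
  also have "\<dots> \<le> (card (I \<times> I) + N) * q ^ (card I - 1)"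
    using I by (intro mult_right_mono add_mono card_mono) auto
  finally have "card E \<le> ((card I)\<^sup>2 + N) * q ^ (card I - 1)"
    unfolding card_cartesian_product Power.power2_eq_square .
  then have "real (card E) \<le> real (((card I)\<^sup>2 + N) * q ^ (card I - 1))" by (simp only: of_nat_le_iff)
  then have "2 ^ N * real (card E) \<le> 2 ^ N * (real q ^ (card I - 1) * ((card I)\<^sup>2 + N))"
    by (intro mult_left_mono) (simp_all add: mult.commute)
  then show ?thesis using main err unfolding D_def T_def V_def
    by (simp add: algebra_simps abs_le_iff)
qed

section \<open>From tuples to Diophantine sets\<close>

text \<open>The condition on sequences of $k$ distinct elements depends only on the set of their values.\<close>

lemma diophantine_tuple_iff:
  "diophantine_tuple k m R A \<longleftrightarrow> A \<subseteq> carrier R \<and> finite A \<and> card A = m \<and>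
     (\<forall>B. B \<subseteq> A \<and> card B = k \<longrightarrow> square_in R (monomial (\<lambda>b. b) B \<oplus> \<one>))"
proof -
  have prod: "(\<Otimes>i\<in>{1..k}. a i) = monomial (\<lambda>b. b) (a ` {1..k})"
    if "A \<subseteq> carrier R" "a \<in> {1..k} \<rightarrow> A" "inj_on a {1..k}" for a :: "nat \<Rightarrow> 'a"
    unfolding monomial_def using that by (subst R.finprod_reindex) auto
  have "(\<forall>a. a \<in> {1..k} \<rightarrow> A \<and> inj_on a {1..k} \<longrightarrow> square_in R ((\<Otimes>i\<in>{1..k}. a i) \<oplus> \<one>)) \<longleftrightarrow>
     (\<forall>B. B \<subseteq> A \<and> card B = k \<longrightarrow> square_in R (monomial (\<lambda>b. b) B \<oplus> \<one>))" (is "?L \<longleftrightarrow> ?R")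
    if A: "A \<subseteq> carrier R" "finite A"
  proof (intro iffI allI impI; elim conjE)
    fix B assume L: ?L and B: "B \<subseteq> A" "card B = k"
    then have "finite B" using A finite_subset by blast
    then obtain a where a: "bij_betw a {1..k} B" using ex_bij_betw_nat_finite_1 B(2) by blast
    then have "a \<in> {1..k} \<rightarrow> A" "inj_on a {1..k}" "a ` {1..k} = B"
      using B(1) by (auto simp: bij_betw_def)
    then show "square_in R (monomial (\<lambda>b. b) B \<oplus> \<one>)" using L prod[OF A(1)] by metis
  next
    fix a assume R: ?R and a: "a \<in> {1..k} \<rightarrow> A" "inj_on a {1..k}"
    then have "a ` {1..k} \<subseteq> A" "card (a ` {1..k}) = k" by (auto simp: card_image)
    then show "square_in R ((\<Otimes>i\<in>{1..k}. a i) \<oplus> \<one>)" using R prod[OF A(1) a] by metis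
  qed
  then show ?thesis unfolding diophantine_tuple_def by blast
qed

lemma good_tuple_iff_diophantine:
  assumes x: "x \<in> {..<m} \<rightarrow>\<^sub>E carrier R" and inj: "inj_on x {..<m}"
  shows "good_tuple k {..<m} x \<longleftrightarrow> diophantine_tuple k m R (x ` {..<m})"
proof -
  have mono: "monomial (\<lambda>b. b) (x ` S) = monomial x S" and card: "card (x ` S) = card S" if "S \<subseteq> {..<m}" for S
    unfolding monomial_def using that x inj_on_subset[OF inj that]
    by (subst R.finprod_reindex, auto simp: card_image)
  have "(\<forall>B. B \<subseteq> x ` {..<m} \<and> card B = k \<longrightarrow> square_in R (monomial (\<lambda>b. b) B \<oplus> \<one>)) \<longleftrightarrow>
    (\<forall>S. S \<subseteq> {..<m} \<and> card S = k \<longrightarrow> square_in R (monomial x S \<oplus> \<one>))" (is "?L \<longleftrightarrow> ?R")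
  proof (intro iffI allI impI; elim conjE)
    fix S assume ?L "S \<subseteq> {..<m}" "card S = k"
    then show "square_in R (monomial x S \<oplus> \<one>)" using mono[of S] card[of S] by (metis image_mono)
  next
    fix B assume R: ?R and B: "B \<subseteq> x ` {..<m}" "card B = k"
    then obtain S where S: "S \<subseteq> {..<m}" "B = x ` S" by (auto simp: subset_image_iff)
    then show "square_in R (monomial (\<lambda>b. b) B \<oplus> \<one>)" using R B mono[OF S(1)] card[OF S(1)] by metis
  qed
  moreover have "x ` {..<m} \<subseteq> carrier R" "card (x ` {..<m}) = m" using x inj by (auto simp: card_image)
  ultimately show ?thesis unfolding good_tuple_def diophantine_tuple_iff using inj by auto
qed

text \<open>Every Diophantine set of size $m$ has $m!$ enumerations.\<close>

lemma card_good_tuples: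
  "card {x \<in> {..<m} \<rightarrow>\<^sub>E carrier R. good_tuple k {..<m} x} = fact m * card {A. diophantine_tuple k m R A}"
proof -
  define \<A> where "\<A> = {A. diophantine_tuple k m R A}"
  define G where "G = {x \<in> {..<m} \<rightarrow>\<^sub>E carrier R. good_tuple k {..<m} x}"
  define enum where "enum A = {x \<in> {..<m} \<rightarrow>\<^sub>E A. inj_on x {..<m}}" for A :: "'a set"
  have A: "A \<subseteq> carrier R" "finite A" "card A = m" if "A \<in> \<A>" for A
    using that by (auto simp: \<A>_def diophantine_tuple_def)
  have finA: "finite \<A>"
    using A(1) finite_carrier by (intro finite_subset[of \<A> "Pow (carrier R)"]) auto
  have image: "x ` {..<m} = A" if "A \<in> \<A>" "x \<in> enum A" for x A
    using that A[of A] by (intro card_subset_eq) (auto simp: enum_def card_image)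
  have "G = (\<Union>A\<in>\<A>. enum A)"
  proof (intro equalityI subsetI)
    fix x assume "x \<in> G"
    then have x: "x \<in> {..<m} \<rightarrow>\<^sub>E carrier R" "inj_on x {..<m}" "good_tuple k {..<m} x"
      by (auto simp: G_def good_tuple_def)
    then have "x ` {..<m} \<in> \<A>" by (simp add: \<A>_def flip: good_tuple_iff_diophantine)
    moreover have "x \<in> enum (x ` {..<m})" using x by (auto simp: enum_def PiE_def)
    ultimately show "x \<in> (\<Union>A\<in>\<A>. enum A)" by blast
  next
    fix x assume "x \<in> (\<Union>A\<in>\<A>. enum A)"
    then obtain B where B: "B \<in> \<A>" "x \<in> enum B" by blast
    then have x: "x \<in> {..<m} \<rightarrow>\<^sub>E carrier R" "inj_on x {..<m}"
      using A(1)[OF B(1)] by (auto simp: enum_def PiE_def)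
    then show "x \<in> G" using good_tuple_iff_diophantine[OF x] image[OF B] B(1) by (simp add: G_def \<A>_def)
  qed
  moreover have "card (\<Union>A\<in>\<A>. enum A) = (\<Sum>A\<in>\<A>. card (enum A))"
  proof (rule card_UN_disjoint[OF finA])
    have "finite (enum A)" if "A \<in> \<A>" for A
      using A(2)[OF that] by (intro finite_subset[of "enum A" "{..<m} \<rightarrow>\<^sub>E A"] finite_PiE) (auto simp: enum_def)
    then show "\<forall>A\<in>\<A>. finite (enum A)" by blast
    show "\<forall>A\<in>\<A>. \<forall>B\<in>\<A>. A \<noteq> B \<longrightarrow> enum A \<inter> enum B = {}" using image by blast
  qed
  moreover have "card (enum A) = fact m" if "A \<in> \<A>" for A
    unfolding enum_def using A[OF that]
    by (subst card_inj_on_subset_funcset) (auto simp: fact_prod_rev)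
  ultimately show ?thesis unfolding G_def \<A>_def by (simp add: mult.commute)
qed

text \<open>The error term of \<open>good_tuple_count\<close> carries a factor $2^N$, which the division by
$m! \, 2^N$ removes.\<close>

lemma diophantine_count:
  assumes k: "0 < k" "k \<le> m" and B0: "0 \<le> B"
    and B: "\<And>(J :: nat set set) c. finite J \<Longrightarrow> J \<noteq> {} \<Longrightarrow> card J \<le> (m choose k) \<Longrightarrow> inj_on c J \<Longrightarrow>
       (\<And>S. S \<in> J \<Longrightarrow> c S \<in> carrier R \<and> c S \<noteq> \<zero>) \<Longrightarrow>
       \<bar>\<Sum>t\<in>carrier R. \<Prod>S\<in>J. chi (c S \<otimes> t \<oplus> \<one>)\<bar> \<le> B"
  shows "\<bar>real (card {A. diophantine_tuple k m R A}) - real q ^ m / (fact m * 2 ^ (m choose k))\<bar>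
     \<le> real q ^ (m - 1) * (B + m + (m choose k)\<^sup>2 + m\<^sup>2 + (m choose k))"
proof -
  define N a E where "N = m choose k" and "a = card {A. diophantine_tuple k m R A}"
    and "E = real q ^ (m - 1) * (B + m + N\<^sup>2 + m\<^sup>2 + N)"
  have "\<bar>2 ^ N * real (fact m * a) - real q ^ m\<bar> \<le> 2 ^ N * E"
    unfolding a_def E_def N_def
  proof -
    have "\<bar>2 ^ (m choose k) * real (card {x \<in> {..<m} \<rightarrow>\<^sub>E carrier R. good_tuple k {..<m} x}) - real q ^ card {..<m}\<bar>
     \<le> 2 ^ (m choose k) * (real q ^ (card {..<m} - 1) * (B + card {..<m} + (m choose k)\<^sup>2 + (card {..<m})\<^sup>2 + (m choose k)))"
    proof (rule good_tuple_count[OF _ k(1) B0])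
      fix J :: "nat set set" and c
      assume J: "J \<subseteq> {S. S \<subseteq> {..<m} \<and> card S = k}" "J \<noteq> {}" "inj_on c J"
        "\<And>S. S \<in> J \<Longrightarrow> c S \<in> carrier R \<and> c S \<noteq> \<zero>"
      have fin: "finite {S. S \<subseteq> {..<m} \<and> card S = k}" by simp
      have "card J \<le> m choose k" using card_mono[OF fin J(1)] n_subsets[of "{..<m}" k] by simp
      then show "\<bar>\<Sum>t\<in>carrier R. \<Prod>S\<in>J. chi (c S \<otimes> t \<oplus> \<one>)\<bar> \<le> B"
        using J finite_subset[OF J(1) fin] by (intro B) auto
    qed auto
    then show "\<bar>2 ^ (m choose k) * real (fact m * card {A. diophantine_tuple k m R A}) - real q ^ m\<bar>
      \<le> 2 ^ (m choose k) * (real q ^ (m - 1) * (B + m + (m choose k)\<^sup>2 + m\<^sup>2 + (m choose k)))"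
      unfolding card_good_tuples by simp
  qed
  moreover have "\<bar>real a - real q ^ m / (fact m * 2 ^ N)\<bar> * (fact m * 2 ^ N)
      = \<bar>(real a - real q ^ m / (fact m * 2 ^ N)) * (fact m * 2 ^ N)\<bar>"
    by (simp add: abs_mult)
  moreover have "(real a - real q ^ m / (fact m * 2 ^ N)) * (fact m * 2 ^ N) = 2 ^ N * real (fact m * a) - real q ^ m"
    by (simp add: field_simps)
  ultimately have "\<bar>real a - real q ^ m / (fact m * 2 ^ N)\<bar> * (fact m * 2 ^ N) \<le> 2 ^ N * E"
    by (simp only:)
  also have "2 ^ N * E \<le> E * (fact m * 2 ^ N)"
  proof -
    have "0 \<le> E" unfolding E_def using B0 by simp
    then have "E * 1 \<le> E * fact m" by (intro mult_left_mono) (auto simp: fact_ge_1)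
    then have "E * 1 * 2 ^ N \<le> E * fact m * 2 ^ N" by (rule mult_right_mono) simp
    then show ?thesis by (simp add: mult.assoc mult.commute[of "2 ^ N" E])
  qed
  finally have "\<bar>real a - real q ^ m / (fact m * 2 ^ N)\<bar> \<le> E"
    by (rule mult_right_le_imp_le) simp
  then show ?thesis unfolding a_def N_def E_def .
qed

end

text \<open>In the bound $\frac{2D}{M} + \frac{r q}{M} + r$ with $r \le C$ one first fixes $M \ge 2C / \epsilon$, so
that the middle term is at most $\epsilon q / 2$. The other two terms are then constants, at
most $\epsilon q / 2$ for large $q$.\<close>

lemma character_sums_uniformly_small:
  fixes C :: nat
  assumes eps: "0 < (\<epsilon> :: real)"
  shows "\<exists>Q. \<forall>R :: 'a ring. odd_finite_field R \<longrightarrow> Q \<le> order R \<longrightarrow>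
    (\<forall>(J :: 'b set) c. finite J \<longrightarrow> J \<noteq> {} \<longrightarrow> card J \<le> C \<longrightarrow> inj_on c J \<longrightarrow>
      (\<forall>j\<in>J. c j \<in> carrier R \<and> c j \<noteq> \<zero>\<^bsub>R\<^esub>) \<longrightarrow>
      \<bar>\<Sum>t\<in>carrier R. \<Prod>j\<in>J. odd_finite_field.chi R (c j \<otimes>\<^bsub>R\<^esub> t \<oplus>\<^bsub>R\<^esub> \<one>\<^bsub>R\<^esub>)\<bar> \<le> \<epsilon> * order R)"
proof -
  define k where "k = nat \<lceil>2 * C / \<epsilon>\<rceil>"
  define M where "M = 2 * k + 1"
  define D where "D r = M * (r * M + k)" for r
  define Q where "Q = C + 2 * D C + M + 1 + nat \<lceil>2 * (2 * D C + M * C) / (M * \<epsilon>)\<rceil>"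
  have M0: "0 < M" by (simp add: M_def)
  have "2 * C / \<epsilon> \<le> k" unfolding k_def by linarith
  also have "real k \<le> M" by (simp add: M_def)
  finally have MC: "2 * C \<le> M * \<epsilon>" using eps by (simp add: field_simps)
  show ?thesis
  proof (intro exI[of _ Q] allI impI)
    fix R :: "'a ring" and J :: "'b set" and c
    assume "odd_finite_field R" and large: "Q \<le> order R"
      and J: "finite J" "J \<noteq> {}" "card J \<le> C" "inj_on c J" "\<forall>j\<in>J. c j \<in> carrier R \<and> c j \<noteq> \<zero>\<^bsub>R\<^esub>"
    interpret odd_finite_field R "UP R" by fact
    have Dmono: "D (card J) \<le> D C" unfolding D_def using J(3) by (intro mult_left_mono add_mono mult_right_mono) auto
    define s where "s = \<bar>\<Sum>t\<in>carrier R. \<Prod>j\<in>J. chi (c j \<otimes>\<^bsub>R\<^esub> t \<oplus>\<^bsub>R\<^esub> \<one>\<^bsub>R\<^esub>)\<bar>"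
    have "real M * s \<le> 2 * D (card J) + card J * q + M * card J"
      unfolding s_def
    proof (rule character_sum_linear_factors[OF J(1,2) _ _ J(4) M_def D_def])
      show "card J + 2 * D (card J) < q" using J(3) Dmono large unfolding Q_def by linarith
      show "M \<le> q" using large unfolding Q_def by linarith
    qed (use J(5) in auto)
    moreover have "2 * D (card J) + card J * q + M * card J \<le> 2 * D C + C * q + M * C"
      using Dmono J(3) by (intro add_mono mult_right_mono mult_left_mono) auto
    ultimately have "real M * s \<le> real (2 * D C + C * q + M * C)"
      by (meson of_nat_mono order_trans)
    also have "\<dots> = real (2 * D C + M * C) + real C * q" by simp
    also have "real (2 * D C + M * C) \<le> (M * \<epsilon> / 2) * q"
    proof -
      have "2 * (2 * D C + M * C) / (M * \<epsilon>) \<le> Q" unfolding Q_def by linarith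
      also have "real Q \<le> q" using large by simp
      finally show ?thesis using M0 eps by (simp add: field_simps)
    qed
    also have "real C * q \<le> (M * \<epsilon> / 2) * q" using MC by (intro mult_right_mono) auto
    finally have "real M * s \<le> real M * (\<epsilon> * q)" by (simp add: algebra_simps)
    then show "\<bar>\<Sum>t\<in>carrier R. \<Prod>j\<in>J. chi (c j \<otimes>\<^bsub>R\<^esub> t \<oplus>\<^bsub>R\<^esub> \<one>\<^bsub>R\<^esub>)\<bar> \<le> \<epsilon> * real q"
      using M0 unfolding s_def by simp
  qed
qed

theorem corollary1p6:
  fixes F :: "nat \<Rightarrow> 'a ring" and k m :: nat
  assumes "2 \<le> k" and "k \<le> m"
    and "\<And>q. q \<in> odd_prime_powers \<Longrightarrow> field (F q)"
    and "\<And>q. q \<in> odd_prime_powers \<Longrightarrow> order (F q) = q"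
  shows "(\<lambda>q. real (card {A. diophantine_tuple k m (F q) A})
              - real q ^ m / (fact m * 2 ^ (m choose k)))
         \<in> o[inf at_top (principal odd_prime_powers)](\<lambda>q. real q ^ m)"
proof (rule landau_o.smallI)
  fix \<delta> :: real assume \<delta>: "0 < \<delta>"
  \<comment> \<open>The constant in the $O(q^{m-1})$ error term.\<close>
  define K where "K = real (m + (m choose k)\<^sup>2 + m\<^sup>2 + (m choose k))"
  obtain Q where Q: "\<And>R (J :: nat set set) c. odd_finite_field (R :: 'a ring) \<Longrightarrow> Q \<le> order R \<Longrightarrow> finite J \<Longrightarrow> J \<noteq> {} \<Longrightarrow>
      card J \<le> m choose k \<Longrightarrow> inj_on c J \<Longrightarrow> (\<And>j. j \<in> J \<Longrightarrow> c j \<in> carrier R \<and> c j \<noteq> \<zero>\<^bsub>R\<^esub>) \<Longrightarrow>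
      \<bar>\<Sum>t\<in>carrier R. \<Prod>j\<in>J. odd_finite_field.chi R (c j \<otimes>\<^bsub>R\<^esub> t \<oplus>\<^bsub>R\<^esub> \<one>\<^bsub>R\<^esub>)\<bar> \<le> \<delta> / 2 * order R"
    using character_sums_uniformly_small[of "\<delta> / 2" "m choose k"] \<delta> by (metis half_gt_zero)
  have "\<forall>\<^sub>F q in at_top. Q \<le> q \<and> K \<le> \<delta> / 2 * real q"
  proof (intro eventually_conj eventually_ge_at_top)
    show "\<forall>\<^sub>F q in at_top. K \<le> \<delta> / 2 * real q"
      using eventually_ge_at_top[of "nat \<lceil>K * 2 / \<delta>\<rceil>"]
    proof eventually_elim
      case (elim q)
      then have "K * 2 / \<delta> \<le> real q" by linarith
      then show ?case using \<delta> by (simp add: field_simps)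
    qed
  qed
  then show "\<forall>\<^sub>F q in inf at_top (principal odd_prime_powers).
      norm (real (card {A. diophantine_tuple k m (F q) A}) - real q ^ m / (fact m * 2 ^ (m choose k)))
        \<le> \<delta> * norm (real q ^ m)"
    unfolding eventually_inf_principal
  proof eventually_elim
    case (elim q)
    show ?case
    proof
      assume q: "q \<in> odd_prime_powers"
      have field: "odd_finite_field (F q)"
        using assms(3,4)[OF q] q by (simp add: odd_finite_field_def odd_finite_field_axioms_def odd_prime_powers_def)
      interpret odd_finite_field "F q" "UP (F q)" by fact
      have ord: "order (F q) = q" by (rule assms(4)[OF q])
      have "\<bar>real (card {A. diophantine_tuple k m (F q) A}) - real (order (F q)) ^ m / (fact m * 2 ^ (m choose k))\<bar>
          \<le> real (order (F q)) ^ (m - 1) * (\<delta> / 2 * q + m + (m choose k)\<^sup>2 + m\<^sup>2 + (m choose k))"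
      proof (rule diophantine_count)
        fix J :: "nat set set" and c
        assume "finite J" "J \<noteq> {}" "card J \<le> m choose k" "inj_on c J"
          "\<And>j. j \<in> J \<Longrightarrow> c j \<in> carrier (F q) \<and> c j \<noteq> \<zero>\<^bsub>F q\<^esub>"
        then show "\<bar>\<Sum>t\<in>carrier (F q). \<Prod>j\<in>J. chi (c j \<otimes>\<^bsub>F q\<^esub> t \<oplus>\<^bsub>F q\<^esub> \<one>\<^bsub>F q\<^esub>)\<bar> \<le> \<delta> / 2 * real q"
          using Q[OF field, of J c] elim unfolding ord by blast
      qed (use assms(1,2) \<delta> in auto)
      also have "\<dots> = real q ^ (m - 1) * (\<delta> / 2 * q + K)" unfolding ord K_def by simp
      also have "\<dots> \<le> real q ^ (m - 1) * (\<delta> * q)" using elim by (intro mult_left_mono) auto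
      also have "\<dots> = \<delta> * real q ^ m" using assms(1,2) by (cases m) auto
      finally show "norm (real (card {A. diophantine_tuple k m (F q) A}) - real q ^ m / (fact m * 2 ^ (m choose k)))
        \<le> \<delta> * norm (real q ^ m)" unfolding ord by simp
    qed
  qed
qed

end
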